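(* Let $(\psi_\omega^n)_{\omega\in\Omega_n}$, $n=2^J$, be the discrete translation invariant wavelet system with unit norm elements generated by a mother wavelet $\psi$ that is continuously differentiable, and let $(\epsilon_n)_n$ be a sequence of random vectors in $\mathbb R^{n}$ with independent $N(0,\sigma^2)$-distributed entries. Then there is a constant $c>0$ such that for all $z\in\mathbb R$ $$\liminf_{n\to\infty}\mathbf P\left\{\max_{\omega\in\Omega_n}|\langle\psi_\omega^n,\epsilon_n\rangle|\le\sigma\sqrt{2\log n}+\sigma\,\frac{z+\log(c/\pi)}{\sqrt{2\log n}}\right\}\ge\exp(-e^{-z}).$$
   Context: Let $\varphi,\psi\in L^2(\mathbb R)$ be real-valued, compactly supported father and mother wavelets of unit norm generating a multiresolution analysis with orthonormal wavelets. For $j\in\{0,1,\dots\}$, $k\in\{0,\dots,2^j-1\}$ the periodic wavelets and scaling functions on $[0,1]$ are $\psi_{j,k}(t)=2^{j/2}\sum_{m\in\mathbb Z}\psi(2^j(t-m)-k)$ and $\varphi_{j,k}(t)=2^{j/2}\sum_{m\in\mathbb Z}\varphi(2^j(t-m)-k)$; they span the detail spaces $\mathcal W_j$ and scaling spaces $\mathcal V_j$, with $\mathcal V_{j}=\mathcal V_{j-1}\oplus\mathcal W_{j-1}$ (orthogonal sum) and $\bigcup_j\mathcal V_j$ dense in $L^2(0,1)$. For $n=2^J$ the discrete wavelets $\psi_{j,k}^n\in\mathbb R^n$, $0\le j\le J-1$, $0\le k\le 2^j-1$, are defined by $\langle\psi^n_{j,k},u_n\rangle=\langle\psi_{j,k},u\rangle$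 whenever $u_n(l)=\langle\varphi_{J,l},u\rangle$ for $l=0,\dots,n-1$ (i.e. $\psi_{j,k}^n(l)=\langle\psi_{j,k},\varphi_{J,l}\rangle$). With the cyclic translation $(\mathbf T_mu_n)(k)=u_n(k-m)$ (indices modulo $n$), the discrete translation invariant wavelet system is the family of all $\mathbf T_m\psi_{j,k}^n$ with $0\le j\le J-1$, $0\le k\le 2^j-1$, $0\le m\le n-1$; it is written $(\psi^n_\omega)_{\omega\in\Omega_n}$. The limit $n\to\infty$ is along powers of two, and $\sigma>0$ is fixed. *)

theory Defs
  imports "HOL-Probability.Probability"
begin

text \<open>
  Elements of $L^2(\mathbb R)$ are handled through Borel representatives; everything below depends
  on them only up to equality almost everywhere, apart from the notion of support.
\<close>

definition L2_space :: "(real \<Rightarrow> real) set" where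
  "L2_space = {f. f \<in> borel_measurable lborel \<and> integrable lborel (\<lambda>x. (f x)\<^sup>2)}"

definition L2_inner :: "(real \<Rightarrow> real) \<Rightarrow> (real \<Rightarrow> real) \<Rightarrow> real" where
  "L2_inner f g = (LINT x|lborel. f x * g x)"

definition L2_norm :: "(real \<Rightarrow> real) \<Rightarrow> real" where
  "L2_norm f = sqrt (L2_inner f f)"

definition L2_closure :: "(real \<Rightarrow> real) set \<Rightarrow> (real \<Rightarrow> real) set" where
  "L2_closure S = {f \<in> L2_space. \<forall>e>0. \<exists>g\<in>S. L2_norm (\<lambda>x. f x - g x) < e}"

text \<open>
  Closedness makes such a set a union of classes modulo equality almost everywhere.
\<close>

definition L2_closed_subspace :: "(real \<Rightarrow> real) set \<Rightarrow> bool" where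
  "L2_closed_subspace S \<longleftrightarrow>
     S \<subseteq> L2_space \<and> (\<lambda>x. 0) \<in> S \<and>
     (\<forall>f\<in>S. \<forall>g\<in>S. (\<lambda>x. f x + g x) \<in> S) \<and>
     (\<forall>a. \<forall>f\<in>S. (\<lambda>x. a * f x) \<in> S) \<and>
     L2_closure S \<subseteq> S"

definition L2_span :: "(int \<Rightarrow> real \<Rightarrow> real) \<Rightarrow> (real \<Rightarrow> real) set" where
  "L2_span e = {f. \<exists>A a. finite A \<and> f = (\<lambda>x. \<Sum>k\<in>A. a k * e k x)}"

definition L2_orthonormal_basis :: "(int \<Rightarrow> real \<Rightarrow> real) \<Rightarrow> (real \<Rightarrow> real) set \<Rightarrow> bool" where
  "L2_orthonormal_basis e S \<longleftrightarrow>
     (\<forall>k. e k \<in> S) \<and>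
     (\<forall>k l. L2_inner (e k) (e l) = (if k = l then 1 else 0)) \<and>
     S \<subseteq> L2_closure (L2_span e)"

definition int_translates :: "(real \<Rightarrow> real) \<Rightarrow> int \<Rightarrow> real \<Rightarrow> real" where
  "int_translates f k x = f (x - of_int k)"

text \<open>
  The spaces increase with the index, so that index \<open>j\<close> corresponds to resolution $2^{-j}$.
\<close>

definition multiresolution_analysis ::
    "(int \<Rightarrow> (real \<Rightarrow> real) set) \<Rightarrow> (real \<Rightarrow> real) \<Rightarrow> bool" where
  "multiresolution_analysis V \<phi> \<longleftrightarrow>
     (\<forall>j. L2_closed_subspace (V j)) \<and>
     (\<forall>j. V j \<subseteq> V (j + 1)) \<and>
     L2_closure (\<Union>j. V j) = L2_space \<and>
     (\<forall>f \<in> (\<Inter>j. V j). AE x in lborel. f x = 0) \<and>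
     (\<forall>j f. f \<in> V j \<longleftrightarrow> (\<lambda>x. f (2 * x)) \<in> V (j + 1)) \<and>
     L2_orthonormal_basis (int_translates \<phi>) (V 0)"

definition detail_space :: "(int \<Rightarrow> (real \<Rightarrow> real) set) \<Rightarrow> int \<Rightarrow> (real \<Rightarrow> real) set" where
  "detail_space V j = {f \<in> V (j + 1). \<forall>g \<in> V j. L2_inner f g = 0}"

text \<open>
  Square integrability and unit norm of both functions are part of the orthonormal basis
  conditions.
\<close>

definition father_mother_wavelets :: "(real \<Rightarrow> real) \<Rightarrow> (real \<Rightarrow> real) \<Rightarrow> bool" where
  "father_mother_wavelets \<phi> \<psi> \<longleftrightarrow>
     (\<exists>V. multiresolution_analysis V \<phi> \<and>
          L2_orthonormal_basis (int_translates \<psi>) (detail_space V 0))"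

definition compactly_supported :: "(real \<Rightarrow> real) \<Rightarrow> bool" where
  "compactly_supported f \<longleftrightarrow> compact (closure {x. f x \<noteq> 0})"

text \<open>
  For compactly supported \<open>f\<close> the series has only finitely many nonzero terms for each \<open>t\<close>.
\<close>

definition periodic_dilate :: "(real \<Rightarrow> real) \<Rightarrow> nat \<Rightarrow> nat \<Rightarrow> real \<Rightarrow> real" where
  "periodic_dilate f j k t =
     2 powr (real j / 2) * (\<Sum>\<^sub>\<infinity>m::int. f (2 ^ j * (t - of_int m) - real k))"

text \<open>
  A vector in $\mathbb R^n$ is a function on \<open>nat\<close> of which only the values at
  \<open>l < n\<close> matter; here \<open>n = 2 ^ J\<close>.
\<close>

definition discrete_wavelet ::
    "(real \<Rightarrow> real) \<Rightarrow> (real \<Rightarrow> real) \<Rightarrow> nat \<Rightarrow> nat \<Rightarrow> nat \<Rightarrow> nat \<Rightarrow> real" where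
  "discrete_wavelet \<phi> \<psi> J j k l =
     (LINT t:{0..1}|lborel. periodic_dilate \<psi> j k t * periodic_dilate \<phi> J l t)"

definition cyclic_translate :: "nat \<Rightarrow> nat \<Rightarrow> (nat \<Rightarrow> real) \<Rightarrow> nat \<Rightarrow> real" where
  "cyclic_translate n m u k = u (nat ((int k - int m) mod int n))"

definition vec_inner :: "nat \<Rightarrow> (nat \<Rightarrow> real) \<Rightarrow> (nat \<Rightarrow> real) \<Rightarrow> real" where
  "vec_inner n u v = (\<Sum>l<n. u l * v l)"

definition ti_index :: "nat \<Rightarrow> (nat \<times> nat \<times> nat) set" where
  "ti_index J = {(j, k, m). j < J \<and> k < 2 ^ j \<and> m < 2 ^ J}"

definition ti_wavelet ::
    "(real \<Rightarrow> real) \<Rightarrow> (real \<Rightarrow> real) \<Rightarrow> nat \<Rightarrow> nat \<times> nat \<times> nat \<Rightarrow> nat \<Rightarrow> real" where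
  "ti_wavelet \<phi> \<psi> J = (\<lambda>(j, k, m). cyclic_translate (2 ^ J) m (discrete_wavelet \<phi> \<psi> J j k))"

end

theory Submission imports Defs "HOL-Real_Asymp.Real_Asymp" begin

text \<open>
  The probability in question tends to 1, so every \<open>c > 0\<close> works. The vectors of one scale are the
  \<open>n = 2 ^ J\<close> translates of a single vector of norm at most 1. A union bound over all
  \<open>n log n\<close> of them is too weak by a factor \<open>sqrt (log n)\<close>. However, \<open>\<psi>\<close> is Lipschitz, so at scale
  \<open>j\<close> it suffices to sample about \<open>2 ^ (j + b)\<close> translates, where \<open>2 ^ b\<close> exceeds a power of \<open>log n\<close>. This
  leaves at most \<open>2 (b + 1) n\<close> vectors, whereas the Gaussian tail at the level
  \<open>sqrt (2 log n) + O (1 / sqrt (log n))\<close> is of order \<open>1 / (n sqrt (log n))\<close>, so it is enough that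
  \<open>b = o (sqrt (log n))\<close>.
\<close>

section \<open>Square-integrable functions\<close>

text \<open>A discrete wavelet is the coefficient vector of a periodized wavelet with respect to the
  orthonormal periodized scaling functions of level \<open>J\<close>. Bessel's inequality therefore
  bounds the Euclidean norms of the discrete vectors, and equally of their differences, by norms of
  functions on the circle, where the smoothness of \<psi> can be used directly. One cyclic step on
  the grid moves the argument of \<psi> at scale \<open>j\<close> by only
  \<open>2 ^ j / 2 ^ J\<close>, which is why coarse scales can be sampled sparsely. The price of
  rounding to a sample point has to be of order \<open>1 / u\<close> at level \<open>u\<close>: then
  \<open>(u - 1 / u)\<^sup>2\<close> differs from \<open>u\<^sup>2\<close> by less than 2. The
  rounding errors get a union bound of their own over every shift of every scale.\<close>

lemma L2_space_mult_integrable: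
  assumes "f \<in> L2_space" "g \<in> L2_space"
  shows "integrable lborel (\<lambda>x. f x * g x)"
proof (rule Bochner_Integration.integrable_bound)
  show "integrable lborel (\<lambda>x. (f x)\<^sup>2 + (g x)\<^sup>2)"
    using assms by (auto simp: L2_space_def)
  show "(\<lambda>x. f x * g x) \<in> borel_measurable lborel"
    using assms by (auto simp: L2_space_def)
  show "AE x in lborel. norm (f x * g x) \<le> norm ((f x)\<^sup>2 + (g x)\<^sup>2)"
  proof (rule AE_I2)
    fix x
    have "2 * \<bar>f x * g x\<bar> \<le> (f x)\<^sup>2 + (g x)\<^sup>2"
      using sum_squares_bound[of "\<bar>f x\<bar>" "\<bar>g x\<bar>"] by (simp add: abs_mult)
    then show "norm (f x * g x) \<le> norm ((f x)\<^sup>2 + (g x)\<^sup>2)" by simp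
  qed
qed

lemma L2_space_add:
  assumes "f \<in> L2_space" "g \<in> L2_space"
  shows "(\<lambda>x. f x + g x) \<in> L2_space"
  using L2_space_mult_integrable[OF assms] assms
  by (auto simp: L2_space_def power2_sum mult.assoc)

lemma L2_space_cmult: "f \<in> L2_space \<Longrightarrow> (\<lambda>x. c * f x) \<in> L2_space"
  by (auto simp: L2_space_def power_mult_distrib)

lemma L2_space_diff:
  assumes "f \<in> L2_space" "g \<in> L2_space"
  shows "(\<lambda>x. f x - g x) \<in> L2_space"
  using L2_space_add[OF assms(1) L2_space_cmult[OF assms(2), of "-1"]] by simp

lemma L2_space_zero: "(\<lambda>x. 0) \<in> L2_space"
  by (auto simp: L2_space_def)

lemma L2_space_sum:
  "(\<And>i. i \<in> A \<Longrightarrow> f i \<in> L2_space) \<Longrightarrow> (\<lambda>x. \<Sum>i\<in>A. f i x) \<in> L2_space"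
  by (induction A rule: infinite_finite_induct) (auto simp: L2_space_zero L2_space_add)

lemma L2_space_affine:
  assumes "f \<in> L2_space" "c \<noteq> 0"
  shows "(\<lambda>x. f (c * x + t)) \<in> L2_space"
proof -
  have "integrable lborel (\<lambda>x. (f (t + c * x))\<^sup>2)"
    using lborel_integrable_real_affine[of "\<lambda>x. (f x)\<^sup>2" c t] assms by (auto simp: L2_space_def)
  then show ?thesis using assms by (auto simp: L2_space_def add.commute)
qed

lemma L2_space_indicator:
  assumes "f \<in> L2_space" "S \<in> sets borel"
  shows "(\<lambda>x. indicator S x * f x) \<in> L2_space"
proof -
  have "integrable lborel (\<lambda>x. indicator S x *\<^sub>R (f x)\<^sup>2)"
    using assms by (intro integrable_mult_indicator) (auto simp: L2_space_def)
  moreover have "(\<lambda>x. indicator S x *\<^sub>R (f x)\<^sup>2) = (\<lambda>x. (indicator S x * f x)\<^sup>2)"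
    by (auto simp: fun_eq_iff indicator_def)
  ultimately show ?thesis using assms by (auto simp: L2_space_def)
qed

lemma L2_inner_commute: "L2_inner f g = L2_inner g f"
  by (simp add: L2_inner_def mult.commute)

lemma L2_inner_diff_left:
  assumes "f \<in> L2_space" "g \<in> L2_space" "h \<in> L2_space"
  shows "L2_inner (\<lambda>x. f x - g x) h = L2_inner f h - L2_inner g h"
  using assms by (simp add: L2_inner_def left_diff_distrib L2_space_mult_integrable)

lemma L2_inner_sum_left:
  assumes "\<And>i. i \<in> A \<Longrightarrow> e i \<in> L2_space" "h \<in> L2_space"
  shows "L2_inner (\<lambda>x. \<Sum>i\<in>A. a i * e i x) h = (\<Sum>i\<in>A. a i * L2_inner (e i) h)"
proof -
  have "L2_inner (\<lambda>x. \<Sum>i\<in>A. a i * e i x) h = (LINT x|lborel. (\<Sum>i\<in>A. a i * (e i x * h x)))"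
    by (simp add: L2_inner_def sum_distrib_right mult.assoc)
  also have "\<dots> = (\<Sum>i\<in>A. LINT x|lborel. a i * (e i x * h x))"
    using assms by (intro Bochner_Integration.integral_sum integrable_mult_right
        L2_space_mult_integrable) auto
  finally show ?thesis by (simp add: L2_inner_def)
qed

text \<open>The residual of \<open>f\<close> after projection onto the \<open>e i\<close> has
  nonnegative square, and expanding it gives the claim. Only semidefiniteness of
  \<open>L2_inner\<close> enters, so working with representatives instead of classes does no
  harm.\<close>

lemma L2_bessel:
  fixes e :: "'i \<Rightarrow> real \<Rightarrow> real"
  assumes "finite A" and f: "f \<in> L2_space" and e: "\<And>i. i \<in> A \<Longrightarrow> e i \<in> L2_space"
    and orth: "\<And>i k. i \<in> A \<Longrightarrow> k \<in> A \<Longrightarrow> L2_inner (e i) (e k) = (if i = k then 1 else 0)"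
  shows "(\<Sum>i\<in>A. (L2_inner f (e i))\<^sup>2) \<le> L2_inner f f"
proof -
  define a where "a i = L2_inner f (e i)" for i
  define p where "p = (\<lambda>x. \<Sum>i\<in>A. a i * e i x)"
  have p: "p \<in> L2_space"
    unfolding p_def by (intro L2_space_sum L2_space_cmult e)
  have pf: "L2_inner p f = (\<Sum>i\<in>A. (a i)\<^sup>2)"
    unfolding p_def using L2_inner_sum_left[OF e f, where A = A and a = a]
    by (simp add: a_def L2_inner_commute[of _ f] power2_eq_square)
  have pe: "L2_inner (e k) p = a k" if "k \<in> A" for k
    unfolding L2_inner_commute[of "e k"] p_def
    using L2_inner_sum_left[OF e e[OF that], where A = A and a = a] that assms(1)
    by (simp add: orth if_distrib[of "(*) _"] sum.delta cong: if_cong)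
  have pp: "L2_inner p p = (\<Sum>i\<in>A. (a i)\<^sup>2)"
    using L2_inner_sum_left[where e = e, OF e p, where A = A and a = a] by (simp add: pe power2_eq_square p_def[symmetric])
  define d where "d = (\<lambda>x. f x - p x)"
  have d: "d \<in> L2_space" unfolding d_def by (rule L2_space_diff[OF f p])
  have "0 \<le> L2_inner d d"
    unfolding L2_inner_def by (intro integral_nonneg_AE) auto
  also have "\<dots> = L2_inner d f - L2_inner d p"
    using L2_inner_diff_left[OF f p d] unfolding d_def[symmetric]
    by (simp only: L2_inner_commute[of f d] L2_inner_commute[of p d])
  also have "\<dots> = L2_inner f f - L2_inner p f - (L2_inner f p - L2_inner p p)"
    using L2_inner_diff_left[OF f p f] L2_inner_diff_left[OF f p p] by (simp add: d_def)
  also have "L2_inner f p = L2_inner p f" by (rule L2_inner_commute)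
  finally show ?thesis using pf pp by (simp add: a_def)
qed

text \<open>Bounded support makes every periodization a locally finite sum. Square integrability is
  included so that the class is closed under shifts, dilations and differences as a whole.\<close>

definition L2_compact :: "(real \<Rightarrow> real) set" where
  "L2_compact = {f \<in> L2_space. \<exists>R. \<forall>x. f x \<noteq> 0 \<longrightarrow> \<bar>x\<bar> \<le> R}"

lemma L2_compactI:
  "f \<in> L2_space \<Longrightarrow> (\<And>x. f x \<noteq> 0 \<Longrightarrow> \<bar>x\<bar> \<le> R) \<Longrightarrow> f \<in> L2_compact"
  by (auto simp: L2_compact_def)

lemma L2_compactE:
  assumes "f \<in> L2_compact"
  obtains N :: nat where "f \<in> L2_space" "\<And>x. f x \<noteq> 0 \<Longrightarrow> \<bar>x\<bar> \<le> real N"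
proof -
  obtain R where R: "\<And>x. f x \<noteq> 0 \<Longrightarrow> \<bar>x\<bar> \<le> R" using assms by (auto simp: L2_compact_def)
  obtain N :: nat where "R \<le> real N" using real_arch_simple by blast
  then show ?thesis using that[of N] R assms by (fastforce simp: L2_compact_def)
qed

lemma L2_compact_affine:
  assumes "f \<in> L2_compact" "c \<noteq> 0"
  shows "(\<lambda>x. f (c * x + t)) \<in> L2_compact"
proof -
  obtain N where N: "f \<in> L2_space" "\<And>x. f x \<noteq> 0 \<Longrightarrow> \<bar>x\<bar> \<le> real N"
    using L2_compactE[OF assms(1)] by blast
  show ?thesis
  proof (rule L2_compactI[where R = "(real N + \<bar>t\<bar>) / \<bar>c\<bar>"])
    show "(\<lambda>x. f (c * x + t)) \<in> L2_space" by (rule L2_space_affine[OF N(1) assms(2)])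
    fix x assume "f (c * x + t) \<noteq> 0"
    then have "\<bar>c * x + t\<bar> \<le> real N" by (rule N(2))
    then have "\<bar>c * x\<bar> \<le> real N + \<bar>t\<bar>" by linarith
    then show "\<bar>x\<bar> \<le> (real N + \<bar>t\<bar>) / \<bar>c\<bar>"
      using assms(2) by (simp add: abs_mult field_simps)
  qed
qed

lemma L2_compact_shift: "f \<in> L2_compact \<Longrightarrow> (\<lambda>x. f (x - t)) \<in> L2_compact"
  using L2_compact_affine[of f 1 "-t"] by simp

lemma L2_compact_diff:
  assumes "f \<in> L2_compact" "g \<in> L2_compact"
  shows "(\<lambda>x. f x - g x) \<in> L2_compact"
proof -
  obtain N where N: "f \<in> L2_space" "\<And>x. f x \<noteq> 0 \<Longrightarrow> \<bar>x\<bar> \<le> real N"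
    using L2_compactE[OF assms(1)] by blast
  obtain N' where N': "g \<in> L2_space" "\<And>x. g x \<noteq> 0 \<Longrightarrow> \<bar>x\<bar> \<le> real N'"
    using L2_compactE[OF assms(2)] by blast
  show ?thesis
  proof (rule L2_compactI[where R = "real N + real N'"])
    show "(\<lambda>x. f x - g x) \<in> L2_space" by (rule L2_space_diff[OF N(1) N'(1)])
    fix x assume "f x - g x \<noteq> 0"
    then have "f x \<noteq> 0 \<or> g x \<noteq> 0" by auto
    then show "\<bar>x\<bar> \<le> real N + real N'" using N(2)[of x] N'(2)[of x] by fastforce
  qed
qed

lemma L2_compact_cmult: "f \<in> L2_compact \<Longrightarrow> (\<lambda>x. c * f x) \<in> L2_compact"
  by (auto simp: L2_compact_def L2_space_cmult)

section \<open>Periodization\<close>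

definition periodize :: "(real \<Rightarrow> real) \<Rightarrow> real \<Rightarrow> real" where
  "periodize g t = (\<Sum>\<^sub>\<infinity>m::int. g (t - of_int m))"

definition periodic_part :: "(real \<Rightarrow> real) \<Rightarrow> real \<Rightarrow> real" where
  "periodic_part g t = indicator {0..1} t * periodize g t"

text \<open>The inner product of two periodizations over one period, written without a fundamental
  domain. In this form invariance under a common real shift, and under an integer shift of one
  argument, is immediate.\<close>

definition periodic_inner :: "(real \<Rightarrow> real) \<Rightarrow> (real \<Rightarrow> real) \<Rightarrow> real" where
  "periodic_inner g h = (\<Sum>\<^sub>\<infinity>p::int. L2_inner g (\<lambda>x. h (x - of_int p)))"

lemma periodize_finite:
  assumes "\<And>x. g x \<noteq> 0 \<Longrightarrow> \<bar>x\<bar> \<le> R" "\<bar>t\<bar> + R \<le> real N"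
  shows "periodize g t = (\<Sum>m\<in>{- int N..int N}. g (t - of_int m))"
proof -
  have "g (t - of_int m) = 0" if "m \<notin> {- int N..int N}" for m
  proof (rule ccontr)
    assume "g (t - of_int m) \<noteq> 0"
    then have "\<bar>t - of_int m\<bar> \<le> R" by (rule assms(1))
    then have "\<bar>of_int m :: real\<bar> \<le> real N" using assms(2) by linarith
    then show False using that by auto
  qed
  then have "periodize g t = infsum (\<lambda>m. g (t - of_int m)) {- int N..int N}"
    unfolding periodize_def by (intro infsum_cong_neutral) auto
  then show ?thesis by simp
qed

lemma periodize_shift_int: "periodize g (t - of_int q) = periodize g t"
proof -
  have "periodize g (t - of_int q) = (\<Sum>\<^sub>\<infinity>m::int. (\<lambda>m. g (t - of_int m)) (q + m))"
    by (simp add: periodize_def algebra_simps)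
  also have "\<dots> = (\<Sum>\<^sub>\<infinity>m::int. g (t - of_int m))"
    by (rule infsum_reindex_bij_betw) (rule bij_plus)
  finally show ?thesis by (simp add: periodize_def)
qed

text \<open>The integer translates of the unit interval tile the line: exactly one integer,
  \<open>- \<lfloor>x\<rfloor>\<close>, moves \<open>x\<close> into \<open>{0..<1}\<close>, and
  \<open>1 + R \<le> real N\<close> keeps it in the range of summation wherever \<open>F x\<close>
  is nonzero.\<close>

lemma integral_unfold_periodization:
  assumes "integrable lborel (F :: real \<Rightarrow> real)" "\<And>x. F x \<noteq> 0 \<Longrightarrow> \<bar>x\<bar> \<le> R" "1 + R \<le> real N"
  shows "(LINT t|lborel. indicator {0..1} t * (\<Sum>m\<in>{- int N..int N}. F (t - of_int m)))
    = (LINT x|lborel. F x)"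
proof -
  have shift: "integrable lborel (\<lambda>t. F (t - of_int m))" for m
    using lborel_integrable_real_affine[OF assms(1), of 1 "- of_int m"] by simp
  have int: "integrable lborel (\<lambda>t. indicator {0..<1} t * F (t - of_int m))" for m
    using integrable_mult_indicator[OF _ shift, of "{0..<1}"] by simp
  have int': "integrable lborel (\<lambda>x. indicator {0..<1} (x + of_int m) * F x)" for m
    using lborel_integrable_real_affine[OF int[of m], of 1 "of_int m"] by (simp add: add.commute)
  have "(LINT t|lborel. indicator {0..1} t * (\<Sum>m\<in>{- int N..int N}. F (t - of_int m)))
      = (LINT t|lborel. (\<Sum>m\<in>{- int N..int N}. indicator {0..<1} t * F (t - of_int m)))"
  proof (rule integral_cong_AE)
    \<comment> \<open>The closed interval comes from the definition of the discrete wavelets.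
      Dropping the null set \<open>{1}\<close> makes the tiles disjoint.\<close>
    show "AE t in lborel. indicator {0..1} t * (\<Sum>m\<in>{- int N..int N}. F (t - of_int m))
      = (\<Sum>m\<in>{- int N..int N}. indicator {0..<1} t * F (t - of_int m))"
      using AE_lborel_singleton[of "1::real"]
      by eventually_elim (auto simp: sum_distrib_left indicator_def)
  qed (use shift in \<open>auto intro!: borel_measurable_sum borel_measurable_times dest: borel_measurable_integrable\<close>)
  also have "\<dots> = (\<Sum>m\<in>{- int N..int N}. LINT t|lborel. indicator {0..<1} t * F (t - of_int m))"
    by (rule Bochner_Integration.integral_sum) (rule int)
  also have "\<dots> = (\<Sum>m\<in>{- int N..int N}. LINT x|lborel. indicator {0..<1} (x + of_int m) * F x)"
  proof (rule sum.cong[OF refl])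
    fix m :: int
    show "(LINT t|lborel. indicator {0..<1} t * F (t - of_int m))
        = (LINT x|lborel. indicator {0..<1} (x + of_int m) * F x)"
      using lborel_integral_real_affine[of 1 "\<lambda>t. indicator {0..<1} t * F (t - of_int m)" "of_int m"]
      by (simp add: add.commute)
  qed
  also have "\<dots> = (LINT x|lborel. (\<Sum>m\<in>{- int N..int N}. indicator {0..<1} (x + of_int m) * F x))"
    by (rule Bochner_Integration.integral_sum[symmetric]) (rule int')
  also have "\<dots> = (LINT x|lborel. F x)"
  proof (rule Bochner_Integration.integral_cong[OF refl])
    fix x :: real
    have "(\<Sum>m\<in>{- int N..int N}. indicator {0..<1} (x + of_int m) * F x)
      = (\<Sum>m\<in>{- int N..int N}. if m = - \<lfloor>x\<rfloor> then F x else 0)"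
      by (intro sum.cong refl) (auto simp: indicator_def; linarith)
    also have "\<dots> = F x"
    proof (cases "F x = 0")
      case False
      then have "\<bar>x\<bar> \<le> R" by (rule assms(2))
      then have "- \<lfloor>x\<rfloor> \<in> {- int N..int N}" using assms(3) by auto linarith+
      then show ?thesis by simp
    qed simp
    finally show "(\<Sum>m\<in>{- int N..int N}. indicator {0..<1} (x + of_int m) * F x) = F x" .
  qed
  finally show ?thesis .
qed

lemma periodic_part_finite:
  assumes "\<And>x. g x \<noteq> 0 \<Longrightarrow> \<bar>x\<bar> \<le> R" "1 + R \<le> real N"
  shows "periodic_part g t = indicator {0..1} t * (\<Sum>m\<in>{- int N..int N}. g (t - of_int m))"
  using periodize_finite[OF assms(1), where t = t and N = N] assms(2)
  by (auto simp: periodic_part_def indicator_def)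

lemma periodic_part_L2_space:
  assumes "g \<in> L2_compact"
  shows "periodic_part g \<in> L2_space"
proof -
  obtain R where R: "g \<in> L2_space" "\<And>x. g x \<noteq> 0 \<Longrightarrow> \<bar>x\<bar> \<le> real R"
    using L2_compactE[OF assms] by blast
  have "periodic_part g = (\<lambda>t. indicator {0..1} t *
      (\<Sum>m\<in>{- int (R + 1)..int (R + 1)}. g (1 * t + - of_int m)))"
    using periodic_part_finite[OF R(2), where N = "R + 1"] by (simp add: fun_eq_iff)
  moreover have "(\<lambda>t. indicator {0..1} t * (\<Sum>m\<in>{- int (R + 1)..int (R + 1)}. g (1 * t + - of_int m)))
     \<in> L2_space"
    by (intro L2_space_indicator L2_space_sum L2_space_affine R(1)) auto
  ultimately show ?thesis by simp
qed

lemma periodic_part_diff: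
  assumes "g \<in> L2_compact" "h \<in> L2_compact"
  shows "periodic_part (\<lambda>x. g x - h x) = (\<lambda>t. periodic_part g t - periodic_part h t)"
proof
  fix t
  obtain R where R: "\<And>x. g x \<noteq> 0 \<Longrightarrow> \<bar>x\<bar> \<le> real R"
    using L2_compactE[OF assms(1)] by blast
  obtain R' where R': "\<And>x. h x \<noteq> 0 \<Longrightarrow> \<bar>x\<bar> \<le> real R'"
    using L2_compactE[OF assms(2)] by blast
  have gh: "\<bar>x\<bar> \<le> real (R + R')" if "g x - h x \<noteq> 0" for x
  proof -
    have "g x \<noteq> 0 \<or> h x \<noteq> 0" using that by auto
    then show ?thesis using R[of x] R'[of x] by fastforce
  qed
  note * = periodic_part_finite[where N = "R + R' + 1" and t = t]
  show "periodic_part (\<lambda>x. g x - h x) t = periodic_part g t - periodic_part h t"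
    using *[OF R] *[OF R'] *[OF gh] by (simp add: sum_subtractf algebra_simps)
qed

text \<open>Since \<open>periodize h\<close> has period 1, the product of the two periodizations is
  itself the periodization of \<open>g * periodize h\<close>. Unfolding its integral over one period
  gives an integral over the line, which splits into the correlations of \<open>g\<close> with the
  integer shifts of \<open>h\<close>.\<close>

lemma L2_inner_periodic_part:
  assumes "g \<in> L2_compact" "h \<in> L2_compact"
  shows "L2_inner (periodic_part g) (periodic_part h) = periodic_inner g h"
proof -
  obtain R where R: "g \<in> L2_space" "\<And>x. g x \<noteq> 0 \<Longrightarrow> \<bar>x\<bar> \<le> real R"
    using L2_compactE[OF assms(1)] by blast
  obtain R' where R': "h \<in> L2_space" "\<And>x. h x \<noteq> 0 \<Longrightarrow> \<bar>x\<bar> \<le> real R'"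
    using L2_compactE[OF assms(2)] by blast
  \<comment> \<open>One bound for all truncations: \<open>periodize h\<close> on the support of
    \<open>g\<close>, \<open>periodize g\<close> on the unit interval, the unfolding, and the shifts
    of \<open>h\<close> that still meet \<open>g\<close>.\<close>
  define N where "N = R + R' + 1"
  define F where "F = (\<lambda>x. g x * periodize h x)"
  have F: "F = (\<lambda>x. \<Sum>m\<in>{- int N..int N}. g x * h (x - of_int m))"
  proof
    fix x
    show "F x = (\<Sum>m\<in>{- int N..int N}. g x * h (x - of_int m))"
    proof (cases "g x = 0")
      case False
      then have "\<bar>x\<bar> \<le> real R" by (rule R(2))
      then have "periodize h x = (\<Sum>m\<in>{- int N..int N}. h (x - of_int m))"
        by (intro periodize_finite[OF R'(2)]) (auto simp: N_def)
      then show ?thesis by (simp add: F_def sum_distrib_left)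
    qed (simp add: F_def)
  qed
  have int: "integrable lborel (\<lambda>x. g x * h (x - of_int m))" for m
    using L2_space_mult_integrable[OF R(1) L2_space_affine[OF R'(1), of 1 "- of_int m"]] by simp
  have Fint: "integrable lborel F" unfolding F by (intro Bochner_Integration.integrable_sum int)
  have "L2_inner (periodic_part g) (periodic_part h)
      = (LINT t|lborel. indicator {0..1} t * (\<Sum>m\<in>{- int N..int N}. F (t - of_int m)))"
    unfolding L2_inner_def
  proof (rule Bochner_Integration.integral_cong[OF refl])
    fix t :: real
    have "periodic_part g t * periodic_part h t
      = indicator {0..1} t * (\<Sum>m\<in>{- int N..int N}. g (t - of_int m)) * periodize h t"
      by (subst periodic_part_finite[OF R(2), where N = N])
         (auto simp: N_def periodic_part_def indicator_def)
    also have "\<dots> = indicator {0..1} t * (\<Sum>m\<in>{- int N..int N}. F (t - of_int m))"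
      by (simp add: F_def periodize_shift_int sum_distrib_right mult.assoc)
    finally show "periodic_part g t * periodic_part h t
      = indicator {0..1} t * (\<Sum>m\<in>{- int N..int N}. F (t - of_int m))" .
  qed
  also have "\<dots> = (LINT x|lborel. F x)"
    by (rule integral_unfold_periodization[OF Fint, where R = "real R"])
       (use R(2) in \<open>auto simp: F_def N_def\<close>)
  also have "\<dots> = (\<Sum>m\<in>{- int N..int N}. LINT x|lborel. g x * h (x - of_int m))"
    unfolding F by (rule Bochner_Integration.integral_sum) (rule int)
  also have "\<dots> = (\<Sum>\<^sub>\<infinity>m\<in>{- int N..int N}. LINT x|lborel. g x * h (x - of_int m))"
    by simp
  also have "\<dots> = (\<Sum>\<^sub>\<infinity>m::int. LINT x|lborel. g x * h (x - of_int m))"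
  proof (rule infsum_cong_neutral)
    fix m assume m: "m \<in> UNIV - {- int N..int N}"
    have "g x * h (x - of_int m) = 0" for x
    proof (rule ccontr)
      assume "g x * h (x - of_int m) \<noteq> 0"
      then have "\<bar>x\<bar> \<le> real R" "\<bar>x - of_int m\<bar> \<le> real R'" using R(2) R'(2) by auto
      then have "\<bar>of_int m :: real\<bar> \<le> real N" unfolding N_def by simp
      then show False using m by auto
    qed
    then show "(LINT x|lborel. g x * h (x - of_int m)) = 0" by (simp only: Bochner_Integration.integral_zero)
  qed auto
  finally show ?thesis by (simp add: periodic_inner_def L2_inner_def)
qed

lemma periodic_inner_shift:
  "periodic_inner (\<lambda>x. g (x - a)) (\<lambda>x. h (x - a)) = periodic_inner g h"
proof -
  have "L2_inner (\<lambda>x. g (x - a)) (\<lambda>x. h (x - of_int p - a)) = L2_inner g (\<lambda>x. h (x - of_int p))" for p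
    using lborel_integral_real_affine[of 1 "\<lambda>x. g (x - a) * h (x - of_int p - a)" a]
    by (simp add: L2_inner_def algebra_simps)
  then show ?thesis by (simp add: periodic_inner_def)
qed

lemma periodic_inner_shift_int:
  "periodic_inner g (\<lambda>x. h (x - of_int q)) = periodic_inner g h"
proof -
  have "periodic_inner g (\<lambda>x. h (x - of_int q))
    = (\<Sum>\<^sub>\<infinity>p::int. (\<lambda>p. L2_inner g (\<lambda>x. h (x - of_int p))) (q + p))"
    by (simp add: periodic_inner_def algebra_simps)
  also have "\<dots> = (\<Sum>\<^sub>\<infinity>p::int. L2_inner g (\<lambda>x. h (x - of_int p)))"
    by (rule infsum_reindex_bij_betw) (rule bij_plus)
  finally show ?thesis by (simp add: periodic_inner_def)
qed

section \<open>Dilates on the circle and the discrete wavelet system\<close>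

text \<open>The shift is real, not an integer: a cyclic translation on the fine grid is a fractional
  shift at a coarser scale, and the Lipschitz estimate is taken in this parameter.\<close>

definition dilate :: "(real \<Rightarrow> real) \<Rightarrow> nat \<Rightarrow> real \<Rightarrow> real \<Rightarrow> real" where
  "dilate f j a x = 2 powr (real j / 2) * f (2 ^ j * x - a)"

lemma dilate_L2_compact: "f \<in> L2_compact \<Longrightarrow> dilate f j a \<in> L2_compact"
  using L2_compact_cmult[OF L2_compact_affine[of f "2 ^ j" "- a"], of "2 powr (real j / 2)"]
  unfolding dilate_def by simp

lemma dilate_shift: "dilate f j a (x - y) = dilate f j (a + 2 ^ j * y) x"
  by (simp add: dilate_def algebra_simps)

lemma periodic_dilate_eq: "periodic_dilate f j k = periodize (dilate f j (real k))"
  by (simp add: fun_eq_iff periodic_dilate_def periodize_def dilate_def infsum_cmult_right')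

lemma L2_inner_dilate:
  "L2_inner (dilate f j a) (dilate g j b) = L2_inner f (\<lambda>x. g (x - (b - a)))"
proof -
  have pw: "2 powr (real j / 2) * 2 powr (real j / 2) = (2::real) ^ j"
    by (simp add: powr_add[symmetric] powr_realpow)
  have "L2_inner f (\<lambda>x. g (x - (b - a)))
    = 2 ^ j * (LINT x|lborel. f (2 ^ j * x - a) * g (2 ^ j * x - b))"
    using lborel_integral_real_affine[of "2 ^ j" "\<lambda>x. f x * g (x - (b - a))" "- a"]
    by (simp add: L2_inner_def algebra_simps)
  also have "\<dots> = (LINT x|lborel. 2 powr (real j / 2) * 2 powr (real j / 2) *
       (f (2 ^ j * x - a) * g (2 ^ j * x - b)))"
    unfolding pw by simp
  also have "\<dots> = L2_inner (dilate f j a) (dilate g j b)"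
    by (simp add: L2_inner_def dilate_def mult_ac)
  finally show ?thesis by simp
qed

lemma periodic_inner_dilate:
  "periodic_inner (dilate f j a) (dilate g j b)
    = (\<Sum>\<^sub>\<infinity>p::int. L2_inner f (\<lambda>x. g (x - (b - a + 2 ^ j * of_int p))))"
  by (simp add: periodic_inner_def dilate_shift L2_inner_dilate algebra_simps)

text \<open>A full turn of the circle is a shift by \<open>2 ^ j\<close> at scale \<open>j\<close>.
  For \<open>\<bar>q\<bar> < 2 ^ j\<close> the only term that can see a coincidence of translates is
  therefore \<open>p = 0\<close>. The case \<open>q = 0\<close> gives the unit norm of every dilate
  of \<psi>, for any real \<open>a\<close>; the other values of \<open>q\<close> serve the scaling
  functions.\<close>

lemma periodic_inner_dilate_orthonormal:
  assumes "\<And>k l. L2_inner (int_translates f k) (int_translates f l) = (if k = l then 1 else 0)"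
    and "\<bar>q\<bar> < 2 ^ j"
  shows "periodic_inner (dilate f j a) (dilate f j (a + of_int q)) = (if q = 0 then 1 else 0)"
proof -
  have "periodic_inner (dilate f j a) (dilate f j (a + of_int q))
    = (\<Sum>\<^sub>\<infinity>p::int. L2_inner (int_translates f 0) (int_translates f (q + 2 ^ j * p)))"
    by (simp add: periodic_inner_dilate int_translates_def[abs_def] algebra_simps)
  also have "\<dots> = (\<Sum>\<^sub>\<infinity>p::int. if 0 = q + 2 ^ j * p then 1 else 0)"
    by (simp only: assms(1))
  also have "\<dots> = (\<Sum>\<^sub>\<infinity>p\<in>{0::int}. if q = 0 then 1 else 0)"
  proof (rule infsum_cong_neutral)
    fix p :: int
    have *: "p = 0" if "q = - (2 ^ j * p)"
    proof (rule ccontr)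
      assume "p \<noteq> 0"
      then have "2 ^ j * 1 \<le> 2 ^ j * \<bar>p\<bar>" by (intro mult_left_mono) auto
      then show False using that assms(2) by (simp add: abs_mult)
    qed
    show "(if 0 = q + 2 ^ j * p then 1 else 0) = (0::real)" if "p \<in> UNIV - {0}"
      using * that by (auto simp: add_eq_0_iff)
  qed auto
  finally show ?thesis by simp
qed

text \<open>
  Translating by \<open>k\<close> at scale \<open>j\<close> is a cyclic translation by \<open>k * 2 ^ (J - j)\<close> on the grid of
  mesh \<open>2 ^ - J\<close>, so up to repetition a scale contributes \<open>2 ^ J\<close> vectors only.
\<close>

lemma ti_wavelet_eq:
  assumes "\<phi> \<in> L2_compact" "\<psi> \<in> L2_compact" "j < J" "l < 2 ^ J"
  shows "ti_wavelet \<phi> \<psi> J (j, k, m) l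
    = periodic_inner (dilate \<psi> j (2 ^ j / 2 ^ J * real (k * 2 ^ (J - j) + m))) (dilate \<phi> J (real l))"
proof -
  define n :: nat where "n = 2 ^ J"
  define q where "q = (int l - int m) div int n"
  define l' where "l' = nat ((int l - int m) mod int n)"
  have "int l' = int l - int m - int n * q"
    by (simp add: l'_def q_def n_def minus_mult_div_eq_mod)
  then have "real_of_int (int l') = real_of_int (int l - int m - int n * q)" by (rule arg_cong)
  then have l': "real l' = real l - real m - 2 ^ J * of_int q" by (simp add: n_def)
  have "ti_wavelet \<phi> \<psi> J (j, k, m) l = discrete_wavelet \<phi> \<psi> J j k l'"
    by (simp add: ti_wavelet_def cyclic_translate_def l'_def n_def)
  also have "\<dots> = L2_inner (periodic_part (dilate \<psi> j (real k))) (periodic_part (dilate \<phi> J (real l')))"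
    unfolding discrete_wavelet_def L2_inner_def set_lebesgue_integral_def periodic_part_def
      periodic_dilate_eq
    by (intro Bochner_Integration.integral_cong) (auto simp: indicator_def)
  also have "\<dots> = periodic_inner (dilate \<psi> j (real k)) (dilate \<phi> J (real l'))"
    by (intro L2_inner_periodic_part dilate_L2_compact assms)
  \<comment> \<open>The wraparound quotient \<open>q\<close> of the cyclic translation is a whole
    number of turns, invisible on the circle. The common shift by \<open>m / 2 ^ J\<close> then
    turns \<open>l'\<close> back into \<open>l\<close> and transfers the translation to
    \<psi>.\<close>
  also have "\<dots> = periodic_inner (dilate \<psi> j (real k)) (\<lambda>x. dilate \<phi> J (real l') (x - of_int q))"
    by (rule periodic_inner_shift_int[symmetric])
  also have "\<dots> = periodic_inner (\<lambda>x. dilate \<psi> j (real k) (x - real m / 2 ^ J))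
      (\<lambda>x. dilate \<phi> J (real l') (x - real m / 2 ^ J - of_int q))"
    by (rule periodic_inner_shift[symmetric])
  also have "\<dots> = periodic_inner (dilate \<psi> j (real k + 2 ^ j * (real m / 2 ^ J))) (dilate \<phi> J (real l))"
    unfolding dilate_shift l' by (simp add: algebra_simps)
  also have "real k + 2 ^ j * (real m / 2 ^ J) = 2 ^ j / 2 ^ J * real (k * 2 ^ (J - j) + m)"
  proof -
    have "(2::real) ^ J = 2 ^ j * 2 ^ (J - j)"
      using assms(3) by (simp add: power_add[symmetric])
    then show ?thesis by (simp add: field_simps)
  qed
  finally show ?thesis .
qed

text \<open>The bridge from discrete vectors to functions. It is applied to a dilate of \<psi>, for
  the norm bound, and to a difference of two dilates, for the increments.\<close>

lemma periodic_inner_bessel: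
  assumes "\<phi> \<in> L2_compact" "g \<in> L2_compact"
    and "\<And>k l. L2_inner (int_translates \<phi> k) (int_translates \<phi> l) = (if k = l then 1 else 0)"
  shows "(\<Sum>l<2 ^ J. (periodic_inner g (dilate \<phi> J (real l)))\<^sup>2) \<le> periodic_inner g g"
proof -
  have "L2_inner (periodic_part (dilate \<phi> J (real i))) (periodic_part (dilate \<phi> J (real k)))
      = (if i = k then 1 else 0)" if "i < 2 ^ J" "k < 2 ^ J" for i k
  proof -
    have "int i < 2 ^ J" "int k < 2 ^ J" using that by (auto simp flip: of_nat_less_iff)
    then have "\<bar>int k - int i\<bar> < 2 ^ J" by linarith
    from periodic_inner_dilate_orthonormal[OF assms(3) this, where a = "real i"]
    show ?thesis by (auto simp: L2_inner_periodic_part dilate_L2_compact assms)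
  qed
  then have "(\<Sum>l<2 ^ J. (L2_inner (periodic_part g) (periodic_part (dilate \<phi> J (real l))))\<^sup>2)
      \<le> L2_inner (periodic_part g) (periodic_part g)"
    by (intro L2_bessel periodic_part_L2_space dilate_L2_compact assms) auto
  then show ?thesis by (simp add: L2_inner_periodic_part dilate_L2_compact assms)
qed

text \<open>The difference of two dilates is the dilate of one function \<open>D\<close> that is
  bounded by \<open>L * \<bar>a - b\<bar>\<close> on a fixed bounded support, so each correlation of
  \<open>D\<close> with a shift of itself is quadratic in \<open>a - b\<close>. The number of shifts
  that contribute is bounded uniformly in \<open>j\<close>, because shifts by multiples of
  \<open>2 ^ j\<close> are at least 1 apart.\<close>

lemma L2_increment_bound:
  assumes "\<psi> C1_differentiable_on UNIV" "\<psi> \<in> L2_compact"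
  obtains C where "C > 0" "\<And>a b j. \<bar>a - b\<bar> \<le> 1 \<Longrightarrow>
    periodic_inner (\<lambda>x. dilate \<psi> j a x - dilate \<psi> j b x) (\<lambda>x. dilate \<psi> j a x - dilate \<psi> j b x)
      \<le> C * (a - b)\<^sup>2"
proof -
  obtain R where R: "\<psi> \<in> L2_space" "\<And>x. \<psi> x \<noteq> 0 \<Longrightarrow> \<bar>x\<bar> \<le> real R"
    using L2_compactE[OF assms(2)] by blast
  obtain \<psi>' where d: "\<And>x. (\<psi> has_vector_derivative \<psi>' x) (at x)" and c: "continuous_on UNIV \<psi>'"
    using assms(1) by (auto simp: C1_differentiable_on_def)
  \<comment> \<open>\<open>D\<close> lives on \<open>\<bar>x\<bar> \<le> R + 1\<close>, and the
    shifted point \<open>x - (a - b)\<close> can be one unit further out.\<close>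
  have "compact (\<psi>' ` {- real R - 2..real R + 2})"
    by (intro compact_continuous_image continuous_on_subset[OF c]) auto
  then obtain L where L: "L > 0" "\<And>x. x \<in> {- real R - 2..real R + 2} \<Longrightarrow> norm (\<psi>' x) \<le> L"
    using compact_imp_bounded bounded_pos by (metis imageI)
  have lip: "norm (\<psi> y - \<psi> x) \<le> L * norm (y - x)"
    if "x \<in> {- real R - 2..real R + 2}" "y \<in> {- real R - 2..real R + 2}" for x y
  proof (rule differentiable_bound[where S = "{- real R - 2..real R + 2}" and f' = "\<lambda>x h. h *\<^sub>R \<psi>' x"])
    show "(\<psi> has_derivative (\<lambda>h. h *\<^sub>R \<psi>' x)) (at x within {- real R - 2..real R + 2})" for x
      using d[of x] by (auto simp: has_vector_derivative_def intro: has_derivative_at_withinI)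
    show "onorm (\<lambda>h. h *\<^sub>R \<psi>' x) \<le> L" if "x \<in> {- real R - 2..real R + 2}" for x
      by (rule onorm_le) (use L(2)[OF that] in \<open>auto simp: abs_mult mult.commute[of L] intro!: mult_left_mono\<close>)
  qed (use that in auto)
  \<comment> \<open>Twice the half-width \<open>R + 1\<close> of the support of \<open>D\<close>.
    The constant \<open>C\<close> is the number of surviving shifts times the bound for one
    correlation, with \<open>2 * R + 2\<close> the length of the support.\<close>
  define N where "N = 2 * R + 2"
  define C where "C = real (2 * N + 1) * (L\<^sup>2 * (2 * real R + 2))"
  have "periodic_inner (\<lambda>x. dilate \<psi> j a x - dilate \<psi> j b x) (\<lambda>x. dilate \<psi> j a x - dilate \<psi> j b x)
      \<le> C * (a - b)\<^sup>2" if ab: "\<bar>a - b\<bar> \<le> 1" for a b j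
  proof -
    define D where "D x = \<psi> (x - (a - b)) - \<psi> x" for x
    have D0: "\<bar>x\<bar> \<le> real R + 1" if "D x \<noteq> 0" for x
    proof -
      have "\<psi> (x - (a - b)) \<noteq> 0 \<or> \<psi> x \<noteq> 0" using that by (auto simp: D_def)
      then show ?thesis using R(2)[of x] R(2)[of "x - (a - b)"] ab by linarith
    qed
    have Db: "\<bar>D x\<bar> \<le> L * \<bar>a - b\<bar>" for x
    proof (cases "D x = 0")
      case False
      then have "\<bar>x\<bar> \<le> real R + 1" by (rule D0)
      then have "x \<in> {- real R - 2..real R + 2}" "x - (a - b) \<in> {- real R - 2..real R + 2}"
        using ab by (auto simp: abs_le_iff)
      from lip[OF this] show ?thesis by (simp add: D_def abs_minus_commute[of b])
    qed (use L(1) in auto)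
    have DC: "D \<in> L2_compact"
      unfolding D_def by (intro L2_compact_diff L2_compact_shift assms)
    have inner_le: "L2_inner D (\<lambda>x. D (x - y)) \<le> L\<^sup>2 * (2 * real R + 2) * (a - b)\<^sup>2" for y
    proof -
      have "L2_inner D (\<lambda>x. D (x - y))
        \<le> (LINT x|lborel. (L * \<bar>a - b\<bar>)\<^sup>2 * indicator {- real R - 1..real R + 1} x)"
        unfolding L2_inner_def
      proof (rule integral_mono)
        show "integrable lborel (\<lambda>x. D x * D (x - y))"
          using DC L2_compact_shift[OF DC, of y] by (intro L2_space_mult_integrable) (auto simp: L2_compact_def)
        fix x
        show "D x * D (x - y) \<le> (L * \<bar>a - b\<bar>)\<^sup>2 * indicator {- real R - 1..real R + 1} x"
        proof (cases "D x = 0")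
          case False
          have "D x * D (x - y) \<le> \<bar>D x\<bar> * \<bar>D (x - y)\<bar>" by (simp flip: abs_mult)
          also have "\<dots> \<le> (L * \<bar>a - b\<bar>) * (L * \<bar>a - b\<bar>)" by (intro mult_mono Db) (use L(1) in auto)
          finally show ?thesis using D0[OF False] by (simp add: indicator_def power2_eq_square abs_le_iff)
        qed simp
      qed (auto intro!: integrable_mult_right)
      also have "\<dots> = L\<^sup>2 * (2 * real R + 2) * (a - b)\<^sup>2"
        by (simp add: power_mult_distrib)
      finally show ?thesis .
    qed
    have "(\<lambda>x. dilate \<psi> j a x - dilate \<psi> j b x) = dilate D j b"
      by (simp add: fun_eq_iff dilate_def D_def algebra_simps)
    then have "periodic_inner (\<lambda>x. dilate \<psi> j a x - dilate \<psi> j b x) (\<lambda>x. dilate \<psi> j a x - dilate \<psi> j b x)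
      = (\<Sum>\<^sub>\<infinity>p::int. L2_inner D (\<lambda>x. D (x - 2 ^ j * of_int p)))"
      by (simp add: periodic_inner_dilate)
    also have "\<dots> = (\<Sum>\<^sub>\<infinity>p\<in>{- int N..int N}. L2_inner D (\<lambda>x. D (x - 2 ^ j * of_int p)))"
    proof (rule infsum_cong_neutral)
      fix p assume p: "p \<in> UNIV - {- int N..int N}"
      have "D x * D (x - 2 ^ j * of_int p) = 0" for x
      proof (rule ccontr)
        assume "D x * D (x - 2 ^ j * of_int p) \<noteq> 0"
        then have "\<bar>x\<bar> \<le> real R + 1" "\<bar>x - 2 ^ j * of_int p\<bar> \<le> real R + 1" using D0 by auto
        then have "\<bar>2 ^ j * of_int p :: real\<bar> \<le> real N" unfolding N_def by simp
        moreover have "1 * \<bar>of_int p :: real\<bar> \<le> 2 ^ j * \<bar>of_int p\<bar>" by (intro mult_right_mono) auto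
        ultimately have "\<bar>of_int p :: real\<bar> \<le> real N" by (simp add: abs_mult)
        then show False using p by auto
      qed
      then show "L2_inner D (\<lambda>x. D (x - 2 ^ j * of_int p)) = 0"
        by (simp only: L2_inner_def Bochner_Integration.integral_zero)
    qed auto
    also have "\<dots> = (\<Sum>p\<in>{- int N..int N}. L2_inner D (\<lambda>x. D (x - 2 ^ j * of_int p)))" by simp
    also have "\<dots> \<le> (\<Sum>p\<in>{- int N..int N}. L\<^sup>2 * (2 * real R + 2) * (a - b)\<^sup>2)"
      by (intro sum_mono inner_le)
    also have "\<dots> = C * (a - b)\<^sup>2" by (simp add: C_def nat_add_distrib)
    finally show ?thesis .
  qed
  moreover have "C > 0" using L(1) by (simp add: C_def)
  ultimately show ?thesis using that by blast
qed

section \<open>Gaussian tails\<close>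

text \<open>On \<open>x \<ge> t\<close> the density is enlarged by the factor
  \<open>x / t \<ge> 1\<close>, which makes it an exact derivative. The gain \<open>1 / t\<close>
  over a pure exponential bound is essential: it is of order \<open>1 / sqrt J\<close> and has to
  beat the factor \<open>b + 1\<close> of the union bound.\<close>

lemma (in prob_space) std_normal_upper_tail:
  assumes "distributed M lborel X std_normal_density" "t > 0"
  shows "prob {x\<in>space M. X x \<ge> t} \<le> exp (- t\<^sup>2 / 2) / (2 * t)"
proof -
  have "X -` {t..} \<inter> space M = {x\<in>space M. X x \<ge> t}" by auto
  then have "emeasure M {x\<in>space M. X x \<ge> t}
      = (\<integral>\<^sup>+x. ennreal (std_normal_density x) * indicator {t..} x \<partial>lborel)"
    using distributed_emeasure[OF assms(1), of "{t..}"] by simp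
  also have "\<dots> \<le> (\<integral>\<^sup>+x. ennreal (x * exp (- x\<^sup>2 / 2) / (2 * t)) * indicator {t..} x \<partial>lborel)"
  proof (rule nn_integral_mono)
    fix x :: real
    have "std_normal_density x \<le> x * exp (- x\<^sup>2 / 2) / (2 * t)" if "t \<le> x"
    proof -
      have "2 \<le> sqrt (2 * pi)" using pi_gt3 by (intro real_le_rsqrt) auto
      then have "std_normal_density x \<le> 1 / 2 * exp (- x\<^sup>2 / 2)"
        unfolding std_normal_density_def by (intro mult_right_mono divide_left_mono) auto
      also have "\<dots> \<le> x / (2 * t) * exp (- x\<^sup>2 / 2)"
        using that assms(2) by (intro mult_right_mono) (auto simp: field_simps)
      finally show ?thesis by simp
    qed
    then show "ennreal (std_normal_density x) * indicator {t..} x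
      \<le> ennreal (x * exp (- x\<^sup>2 / 2) / (2 * t)) * indicator {t..} x"
      by (auto simp: indicator_def intro!: ennreal_leI)
  qed
  also have "\<dots> = ennreal (0 - (- exp (- t\<^sup>2 / 2) / (2 * t)))"
  proof (rule nn_integral_FTC_atLeast[where F = "\<lambda>x. - exp (- x\<^sup>2 / 2) / (2 * t)"])
    show "((\<lambda>x. - exp (- x\<^sup>2 / 2) / (2 * t)) \<longlongrightarrow> 0) at_top"
      using assms(2) by real_asymp
    show "((\<lambda>x. - exp (- x\<^sup>2 / 2) / (2 * t)) has_real_derivative x * exp (- x\<^sup>2 / 2) / (2 * t)) (at x)" for x
      using assms(2) by (auto intro!: derivative_eq_intros simp: field_simps)
  qed (use assms(2) in auto)
  finally show ?thesis
    using assms(2) by (simp add: emeasure_eq_measure)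
qed

lemma (in prob_space) gaussian_linear_combination_tail:
  fixes X :: "nat \<Rightarrow> 'a \<Rightarrow> real"
  assumes indep: "indep_vars (\<lambda>_. borel) X {..<n}"
    and X: "\<And>l. l < n \<Longrightarrow> distributed M lborel (X l) (normal_density 0 \<sigma>)"
    and "\<sigma> > 0" "S > 0" "t > 0" and v: "(\<Sum>l<n. (v l)\<^sup>2) \<le> S\<^sup>2"
  shows "prob {x\<in>space M. \<sigma> * S * t < \<bar>vec_inner n v (\<lambda>l. X l x)\<bar>} \<le> exp (- t\<^sup>2 / 2) / t"
proof (cases "\<forall>l<n. v l = 0")
  case True
  then have "vec_inner n v (\<lambda>l. X l x) = 0" for x by (simp add: vec_inner_def)
  moreover have "\<not> \<sigma> * S * t < 0" using assms(3-5) by (simp add: not_less)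
  ultimately show ?thesis using assms(5) by simp
next
  case False
  \<comment> \<open>A zero coefficient yields a degenerate variable without a density, so such terms
    are removed before normal variables are summed.\<close>
  define I where "I = {l. l < n \<and> v l \<noteq> 0}"
  define s where "s = sqrt (\<Sum>l\<in>I. (\<bar>v l\<bar> * \<sigma>)\<^sup>2)"
  have I: "finite I" "I \<noteq> {}" "I \<subseteq> {..<n}" using False by (auto simp: I_def)
  have eq: "vec_inner n v (\<lambda>l. X l x) = (\<Sum>l\<in>I. v l * X l x)" for x
    unfolding vec_inner_def by (rule sum.mono_neutral_right) (auto simp: I_def)
  have "(\<Sum>l\<in>I. (\<bar>v l\<bar> * \<sigma>)\<^sup>2) = \<sigma>\<^sup>2 * (\<Sum>l<n. (v l)\<^sup>2)"
    unfolding sum_distrib_left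
    by (rule sum.mono_neutral_cong_left) (auto simp: I_def power_mult_distrib)
  also have "\<dots> \<le> \<sigma>\<^sup>2 * S\<^sup>2" using v by (intro mult_left_mono) auto
  finally have "s \<le> sqrt ((\<sigma> * S)\<^sup>2)" unfolding s_def by (simp add: power_mult_distrib)
  then have sS: "s \<le> \<sigma> * S" using assms(3,4) by simp
  have s: "s > 0" unfolding s_def using I assms(3)
    by (intro real_sqrt_gt_zero sum_pos) (auto simp: I_def)
  have "distributed M lborel (\<lambda>x. \<Sum>l\<in>I. v l * X l x) (normal_density (\<Sum>l\<in>I. 0) s)"
    unfolding s_def
  proof (rule sum_indep_normal)
    show "indep_vars (\<lambda>_. borel) (\<lambda>l x. v l * X l x) I"
      by (rule indep_vars_compose2[OF indep_vars_subset[OF indep I(3)]]) auto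
    show "distributed M lborel (\<lambda>x. v l * X l x) (normal_density 0 (\<bar>v l\<bar> * \<sigma>))" if "l \<in> I" for l
      using normal_density_affine[OF X assms(3), of l "v l" 0] that by (auto simp: I_def)
  qed (use I assms(3) in \<open>auto simp: I_def\<close>)
  then have Y: "distributed M lborel (\<lambda>x. \<Sum>l\<in>I. v l * X l x) (normal_density 0 s)" by simp
  \<comment> \<open>The choices \<open>c = 1 / s\<close> and \<open>c = - 1 / s\<close> give the two
    tails of one standardized variable.\<close>
  have tail: "prob {x\<in>space M. c * (\<Sum>l\<in>I. v l * X l x) \<ge> t} \<le> exp (- t\<^sup>2 / 2) / (2 * t)"
    if "\<bar>c\<bar> = 1 / s" for c
  proof (rule std_normal_upper_tail[OF _ assms(5)])
    have "c \<noteq> 0" using that s by auto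
    then show "distributed M lborel (\<lambda>x. c * (\<Sum>l\<in>I. v l * X l x)) std_normal_density"
      using normal_density_affine[OF Y s, of c 0] that s by simp
  qed
  have [measurable]: "(\<lambda>x. \<Sum>l\<in>I. v l * X l x) \<in> borel_measurable M"
    using distributed_measurable[OF Y] by simp
  have "{x\<in>space M. \<sigma> * S * t < \<bar>vec_inner n v (\<lambda>l. X l x)\<bar>}
    \<subseteq> {x\<in>space M. (1 / s) * (\<Sum>l\<in>I. v l * X l x) \<ge> t} \<union>
      {x\<in>space M. (- 1 / s) * (\<Sum>l\<in>I. v l * X l x) \<ge> t}"
  proof (intro subsetI)
    fix x assume x: "x \<in> {x\<in>space M. \<sigma> * S * t < \<bar>vec_inner n v (\<lambda>l. X l x)\<bar>}"
    have "s * t \<le> \<sigma> * S * t" using sS assms(5) by (intro mult_right_mono) auto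
    then have "s * t \<le> \<bar>\<Sum>l\<in>I. v l * X l x\<bar>" using x by (simp add: eq)
    then have "t \<le> \<bar>\<Sum>l\<in>I. v l * X l x\<bar> / s" using s by (simp add: field_simps)
    then show "x \<in> {x\<in>space M. (1 / s) * (\<Sum>l\<in>I. v l * X l x) \<ge> t} \<union>
      {x\<in>space M. (- 1 / s) * (\<Sum>l\<in>I. v l * X l x) \<ge> t}"
      using x by (auto simp: abs_if split: if_splits)
  qed
  then have "prob {x\<in>space M. \<sigma> * S * t < \<bar>vec_inner n v (\<lambda>l. X l x)\<bar>}
    \<le> prob ({x\<in>space M. (1 / s) * (\<Sum>l\<in>I. v l * X l x) \<ge> t} \<union>
      {x\<in>space M. (- 1 / s) * (\<Sum>l\<in>I. v l * X l x) \<ge> t})"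
    by (rule finite_measure_mono) measurable
  also have "\<dots> \<le> prob {x\<in>space M. (1 / s) * (\<Sum>l\<in>I. v l * X l x) \<ge> t} +
      prob {x\<in>space M. (- 1 / s) * (\<Sum>l\<in>I. v l * X l x) \<ge> t}"
    by (rule measure_Un_le) measurable
  also have "\<dots> \<le> exp (- t\<^sup>2 / 2) / (2 * t) + exp (- t\<^sup>2 / 2) / (2 * t)"
    using s by (intro add_mono tail) auto
  finally show ?thesis using assms(5) by (simp add: field_simps)
qed

section \<open>Union bound over all scales\<close>

text \<open>With truncated subtraction the exponent is the minimum of \<open>j + b\<close> and
  \<open>J\<close>. The scales with \<open>j + b < J\<close> form a geometric sum of at most
  \<open>2 ^ J\<close>, and at most \<open>b\<close> scales remain, each contributing
  \<open>2 ^ J\<close>.\<close>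

lemma sum_grid_sizes_le: "(\<Sum>j<J. (2::real) ^ (J - (J - j - b))) \<le> 2 ^ J * real (b + 1)"
proof -
  have "(\<Sum>j<J. (2::real) ^ (J - (J - j - b))) \<le> (\<Sum>j<J. 2 ^ (j + b) * of_bool (j + b < J) + 2 ^ J * of_bool (J \<le> j + b))"
    by (intro sum_mono) (auto intro!: power_increasing)
  also have "\<dots> = (\<Sum>j<J. 2 ^ (j + b) * of_bool (j + b < J)) + 2 ^ J * real (card {j. j < J \<and> J \<le> j + b})"
    by (simp add: sum.distrib sum_distrib_left[symmetric] of_bool_def sum.If_cases lessThan_def Collect_conj_eq)
  also have "card {j. j < J \<and> J \<le> j + b} \<le> card {J - b..<J}"
    by (intro card_mono) auto
  also have "card {J - b..<J} \<le> b" by simp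
  also have "(\<Sum>j<J. (2::real) ^ (j + b) * of_bool (j + b < J)) = (\<Sum>j<J - b. 2 ^ (j + b))"
    by (rule sum.mono_neutral_cong_right) auto
  also have "\<dots> = 2 ^ b * (2 ^ (J - b) - 1)"
    by (simp add: power_add sum_distrib_right[symmetric] geometric_sum)
  also have "\<dots> \<le> 2 ^ J"
    by (cases "b \<le> J") (auto simp: right_diff_distrib power_add[symmetric])
  finally show ?thesis by (simp add: algebra_simps)
qed

lemma (in prob_space) vec_inner_measurable:
  assumes "\<And>l. l < n \<Longrightarrow> X l \<in> borel_measurable M"
  shows "(\<lambda>x. vec_inner n v (\<lambda>l. X l x)) \<in> borel_measurable M"
  unfolding vec_inner_def by (intro borel_measurable_sum borel_measurable_times assms) auto

text \<open>
  The coefficients at scale \<open>j\<close> are sampled at multiples of \<open>2 ^ (J - j - b)\<close>: there are about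
  \<open>2 ^ (j + b)\<close> sample points, or \<open>2 ^ J\<close> for the \<open>b\<close> finest scales, and between sample points
  the coefficients move by at most \<open>\<sigma> / u\<close>, which changes the tail at \<open>u\<close> only by a constant factor.
\<close>

lemma (in prob_space) multiscale_union_bound:
  fixes X :: "nat \<Rightarrow> 'a \<Rightarrow> real" and v :: "nat \<Rightarrow> nat \<Rightarrow> nat \<Rightarrow> real"
  assumes indep: "indep_vars (\<lambda>_. borel) X {..<2 ^ J}"
    and X: "\<And>l. l < 2 ^ J \<Longrightarrow> distributed M lborel (X l) (normal_density 0 \<sigma>)"
    and \<sigma>: "\<sigma> > 0" and u: "u > 1"
    and norm: "\<And>j s. j < J \<Longrightarrow> (\<Sum>l<2 ^ J. (v j s l)\<^sup>2) \<le> 1"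
    and incr: "\<And>j s s'. j < J \<Longrightarrow> s' \<le> s \<Longrightarrow> s - s' < 2 ^ (J - j - b) \<Longrightarrow>
      (\<Sum>l<2 ^ J. (v j s l - v j s' l)\<^sup>2) \<le> (1 / (2 * u\<^sup>2))\<^sup>2"
  shows "prob {x\<in>space M. \<exists>j<J. \<exists>s<2 ^ (J + 1). \<sigma> * u < \<bar>vec_inner (2 ^ J) (v j s) (\<lambda>l. X l x)\<bar>}
    \<le> 2 ^ (J + 1) * real (b + 1) * (exp (- (u - 1 / u)\<^sup>2 / 2) / (u - 1 / u))
      + real J * 2 ^ (J + 1) * (exp (- (2 * u)\<^sup>2 / 2) / (2 * u))"
proof -
  define Y where "Y w x = vec_inner (2 ^ J) w (\<lambda>l. X l x)" for w x
  have "X l \<in> borel_measurable M" if "l < 2 ^ J" for l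
    using distributed_measurable[OF X[OF that]] by simp
  then have [measurable]: "Y w \<in> borel_measurable M" for w
    unfolding Y_def[abs_def] by (rule vec_inner_measurable)
  \<comment> \<open>Truncated subtraction gives spacing 1 once \<open>j + b \<ge> J\<close>, so on
    the finest scales nothing is rounded. The factor 2 in \<open>N\<close> is there because
    \<open>s\<close> runs up to \<open>2 ^ (J + 1)\<close>.\<close>
  define d :: "nat \<Rightarrow> nat" where "d j = 2 ^ (J - j - b)" for j
  define N :: "nat \<Rightarrow> nat" where "N j = 2 * 2 ^ (J - (J - j - b))" for j
  have Nd: "N j * d j = 2 ^ (J + 1)" for j
    by (simp add: N_def d_def power_add[symmetric] mult.assoc)
  \<comment> \<open>The error of rounding \<open>s\<close> down to the nearest sample point.
    \<open>G\<close> and \<open>H\<close> are the events that a sample or a rounding error is too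
    large; by \<open>gap\<close> their thresholds add up to \<open>\<sigma> * u\<close>.\<close>
  define w where "w j s l = v j s l - v j (d j * (s div d j)) l" for j s l
  define G where "G = (\<lambda>(j, q). {x\<in>space M. \<sigma> * 1 * (u - 1 / u) < \<bar>Y (v j (d j * q)) x\<bar>})"
  define H where "H = (\<lambda>(j, s). {x\<in>space M. \<sigma> * (1 / (2 * u\<^sup>2)) * (2 * u) < \<bar>Y (w j s) x\<bar>})"
  define A where "A = (SIGMA j:{..<J}. {..<N j})"
  define B where "B = {..<J} \<times> {..<2 ^ (J + 1) :: nat}"
  have fin: "finite A" "finite B" by (auto simp: A_def B_def)
  have GH: "G i \<in> events" "H i \<in> events" for i
    by (auto simp: G_def H_def split: prod.split)
  have u1: "u - 1 / u > 0" using u by (simp add: field_simps) (metis less_1_mult)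
  have gap: "\<sigma> * 1 * (u - 1 / u) + \<sigma> * (1 / (2 * u\<^sup>2)) * (2 * u) = \<sigma> * u"
    using u by (simp add: field_simps power2_eq_square)
  have "{x\<in>space M. \<exists>j<J. \<exists>s<2 ^ (J + 1). \<sigma> * u < \<bar>Y (v j s) x\<bar>} \<subseteq> (\<Union>i\<in>A. G i) \<union> (\<Union>i\<in>B. H i)"
  proof
    fix x assume "x \<in> {x\<in>space M. \<exists>j<J. \<exists>s<2 ^ (J + 1). \<sigma> * u < \<bar>Y (v j s) x\<bar>}"
    then obtain j s where js: "x \<in> space M" "j < J" "s < 2 ^ (J + 1)" "\<sigma> * u < \<bar>Y (v j s) x\<bar>" by auto
    have "s div d j < N j"
      using js(3) unfolding Nd[of j, symmetric] by (rule less_mult_imp_div_less)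
    then have "(j, s div d j) \<in> A" "(j, s) \<in> B" using js by (auto simp: A_def B_def)
    moreover have "Y (v j s) x = Y (v j (d j * (s div d j))) x + Y (w j s) x"
      by (simp add: Y_def vec_inner_def w_def sum.distrib[symmetric] algebra_simps)
    then have "\<sigma> * 1 * (u - 1 / u) < \<bar>Y (v j (d j * (s div d j))) x\<bar>
        \<or> \<sigma> * (1 / (2 * u\<^sup>2)) * (2 * u) < \<bar>Y (w j s) x\<bar>"
      using js(4) gap by linarith
    then have "x \<in> G (j, s div d j) \<or> x \<in> H (j, s)"
      using js(1) by (auto simp: G_def H_def)
    ultimately show "x \<in> (\<Union>i\<in>A. G i) \<union> (\<Union>i\<in>B. H i)" by blast
  qed
  then have "prob {x\<in>space M. \<exists>j<J. \<exists>s<2 ^ (J + 1). \<sigma> * u < \<bar>Y (v j s) x\<bar>}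
      \<le> prob ((\<Union>i\<in>A. G i) \<union> (\<Union>i\<in>B. H i))"
    by (rule finite_measure_mono) (use fin GH in auto)
  also have "\<dots> \<le> prob (\<Union>i\<in>A. G i) + prob (\<Union>i\<in>B. H i)"
    by (rule measure_Un_le) (use fin GH in auto)
  also have "\<dots> \<le> (\<Sum>i\<in>A. prob (G i)) + (\<Sum>i\<in>B. prob (H i))"
    by (intro add_mono measure_UNION_le) (use fin GH in auto)
  also have "(\<Sum>i\<in>A. prob (G i)) \<le> (\<Sum>i\<in>A. exp (- (u - 1 / u)\<^sup>2 / 2) / (u - 1 / u))"
  proof (rule sum_mono)
    fix i assume "i \<in> A"
    then obtain j q where i: "i = (j, q)" "j < J" by (auto simp: A_def)
    show "prob (G i) \<le> exp (- (u - 1 / u)\<^sup>2 / 2) / (u - 1 / u)"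
      unfolding i G_def Y_def prod.case
      by (rule gaussian_linear_combination_tail[OF indep X \<sigma>]) (use norm i u1 in auto)
  qed
  also have "(\<Sum>i\<in>B. prob (H i)) \<le> (\<Sum>i\<in>B. exp (- (2 * u)\<^sup>2 / 2) / (2 * u))"
  proof (rule sum_mono)
    fix i assume "i \<in> B"
    then obtain j s where i: "i = (j, s)" "j < J" by (auto simp: B_def)
    have "(\<Sum>l<2 ^ J. (w j s l)\<^sup>2) \<le> (1 / (2 * u\<^sup>2))\<^sup>2"
      unfolding w_def
    proof (rule incr[OF i(2)])
      show "s - d j * (s div d j) < 2 ^ (J - j - b)"
        unfolding minus_mult_div_eq_mod by (simp add: d_def)
    qed simp
    then show "prob (H i) \<le> exp (- (2 * u)\<^sup>2 / 2) / (2 * u)"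
      unfolding i H_def Y_def prod.case
      by (intro gaussian_linear_combination_tail[OF indep X \<sigma>]) (use u in auto)
  qed
  also have "(\<Sum>i\<in>A. exp (- (u - 1 / u)\<^sup>2 / 2) / (u - 1 / u))
      = 2 * (\<Sum>j<J. (2::real) ^ (J - (J - j - b))) * (exp (- (u - 1 / u)\<^sup>2 / 2) / (u - 1 / u))"
    by (simp add: A_def card_SigmaI N_def sum_distrib_left)
  also have "\<dots> \<le> 2 * (2 ^ J * real (b + 1)) * (exp (- (u - 1 / u)\<^sup>2 / 2) / (u - 1 / u))"
    using u1 by (intro mult_right_mono mult_left_mono sum_grid_sizes_le) auto
  finally show ?thesis by (simp add: Y_def B_def mult_ac)
qed

section \<open>Asymptotics of the threshold and of the error term\<close>

text \<open>The exponent \<open>1 / 4\<close> is a convenient choice: \<open>2 ^ b J\<close> must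
  outgrow \<open>(u J)\<^sup>2\<close>, which is of order \<open>J\<close>, while \<open>b J\<close>
  must be negligible against \<open>u J\<close>, which is of order \<open>sqrt J\<close>.\<close>

lemma gumbel_level_limits:
  fixes z C :: real and u :: "nat \<Rightarrow> real" and b :: "nat \<Rightarrow> nat"
  defines "u \<equiv> \<lambda>J. sqrt (2 * ln (2 ^ J)) + z / sqrt (2 * ln (2 ^ J))"
    and "b \<equiv> \<lambda>J. nat \<lfloor>real J powr (1 / 4)\<rfloor>"
  shows "eventually (\<lambda>J. u J > 1) sequentially"
    and "C > 0 \<Longrightarrow> eventually (\<lambda>J. C * (1 / 2 ^ b J)\<^sup>2 \<le> (1 / (2 * (u J)\<^sup>2))\<^sup>2) sequentially"
    and "(\<lambda>J. 2 ^ (J + 1) * real (b J + 1) * (exp (- (u J - 1 / u J)\<^sup>2 / 2) / (u J - 1 / u J))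
      + real J * 2 ^ (J + 1) * (exp (- (2 * u J)\<^sup>2 / 2) / (2 * u J))) \<longlonglongrightarrow> 0"
proof -
  have u: "u J = sqrt (2 * (real J * ln 2)) + z / sqrt (2 * (real J * ln 2))" for J
    by (simp add: u_def ln_realpow)
  show u1: "eventually (\<lambda>J. u J > 1) sequentially" unfolding u by real_asymp
  have b1: "real (b J) \<le> real J powr (1 / 4)" for J unfolding b_def by (simp add: of_nat_floor)
  have b2: "real J powr (1 / 4) - 1 \<le> real (b J)" for J unfolding b_def by linarith
  show "eventually (\<lambda>J. C * (1 / 2 ^ b J)\<^sup>2 \<le> (1 / (2 * (u J)\<^sup>2))\<^sup>2) sequentially" if "C > 0"
  proof -
    \<comment> \<open>The floor in \<open>b\<close> is replaced by its lower bound
      \<open>b2\<close>, leaving a comparison of explicit functions of \<open>J\<close>.\<close>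
    have "eventually (\<lambda>J. C * (4 * (u J) ^ 4) \<le> (2 powr (real J powr (1 / 4) - 1))\<^sup>2) sequentially"
      unfolding u using that by real_asymp
    with u1 show ?thesis
    proof eventually_elim
      case (elim J)
      have "2 powr (real J powr (1 / 4) - 1) \<le> (2::real) ^ b J"
        using b2[of J] by (simp add: powr_realpow[symmetric])
      then have "(2 powr (real J powr (1 / 4) - 1))\<^sup>2 \<le> ((2::real) ^ b J)\<^sup>2" by (intro power_mono) auto
      then have "C * (4 * (u J) ^ 4) \<le> (2 ^ b J)\<^sup>2" using elim(2) by linarith
      moreover have "(2 * (u J)\<^sup>2)\<^sup>2 = 4 * (u J) ^ 4" by (simp add: power_mult_distrib)
      ultimately show ?case using elim(1) by (simp add: power_divide divide_simps mult.commute)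
    qed
  qed
  show "(\<lambda>J. 2 ^ (J + 1) * real (b J + 1) * (exp (- (u J - 1 / u J)\<^sup>2 / 2) / (u J - 1 / u J))
      + real J * 2 ^ (J + 1) * (exp (- (2 * u J)\<^sup>2 / 2) / (2 * u J))) \<longlonglongrightarrow> 0"
  proof (rule tendsto_sandwich[OF _ _ tendsto_const])
    \<comment> \<open>The majorant after the powers of \<open>2 ^ J\<close> cancel:
      \<open>1 / 2 ^ J\<close> from the sample tail against the number of samples, and
      \<open>(1 / 2 ^ J) ^ 4\<close> from the rounding tail, of which three factors survive.\<close>
    show "(\<lambda>J. 2 * (real J powr (1 / 4) + 1) * exp (1 - z) / (u J - 1 / u J)
      + real J * 2 * exp (- 4 * z) * (1 / 2 ^ J) ^ 3) \<longlonglongrightarrow> 0"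
      unfolding u by real_asymp
    have *: "0 \<le> 2 ^ (J + 1) * real (b J + 1) * (exp (- (u J - 1 / u J)\<^sup>2 / 2) / (u J - 1 / u J))
        + real J * 2 ^ (J + 1) * (exp (- (2 * u J)\<^sup>2 / 2) / (2 * u J))
      \<and> 2 ^ (J + 1) * real (b J + 1) * (exp (- (u J - 1 / u J)\<^sup>2 / 2) / (u J - 1 / u J))
        + real J * 2 ^ (J + 1) * (exp (- (2 * u J)\<^sup>2 / 2) / (2 * u J))
      \<le> 2 * (real J powr (1 / 4) + 1) * exp (1 - z) / (u J - 1 / u J)
        + real J * 2 * exp (- 4 * z) * (1 / 2 ^ J) ^ 3" if J: "J > 0" "u J > 1" for J
    proof -
      have du: "u J - 1 / u J > 0" using J(2) by (simp add: field_simps) (metis less_1_mult)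
      define r where "r = sqrt (2 * ln ((2::real) ^ J))"
      have r: "r > 0" "r\<^sup>2 = 2 * ln (2 ^ J)" using J(1) by (auto simp: r_def)
      \<comment> \<open>The cross term is exactly \<open>2 * z\<close>, because the correction to
        \<open>r\<close> is \<open>z / r\<close>. Dropping the last square leaves a lower bound
        valid for either sign of \<open>z\<close>.\<close>
      have "(u J)\<^sup>2 = r\<^sup>2 + 2 * z + (z / r)\<^sup>2"
        using r(1) by (simp add: u_def r_def[symmetric] power2_sum)
      then have u2: "(u J)\<^sup>2 \<ge> 2 * ln (2 ^ J) + 2 * z" using r(2) by simp
      have "(u J - 1 / u J)\<^sup>2 = (u J)\<^sup>2 - 2 + (1 / u J)\<^sup>2"
        using J(2) by (simp add: power2_diff)
      then have "(u J - 1 / u J)\<^sup>2 \<ge> 2 * ln (2 ^ J) + 2 * z - 2"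
        using u2 zero_le_power2[of "1 / u J"] by linarith
      then have "exp (- (u J - 1 / u J)\<^sup>2 / 2) \<le> exp (1 - z + - ln (2 ^ J))" by simp
      also have "\<dots> = exp (1 - z) * (1 / 2 ^ J)" unfolding exp_add exp_minus by (simp add: divide_inverse)
      finally have e1: "exp (- (u J - 1 / u J)\<^sup>2 / 2) \<le> exp (1 - z) * (1 / 2 ^ J)" .
      have "exp (- (2 * u J)\<^sup>2 / 2) \<le> exp (- 4 * z + (- ln (2 ^ J)) * real 4)"
        using u2 by (simp add: power_mult_distrib)
      also have "\<dots> = exp (- 4 * z) * (1 / 2 ^ J) ^ 4"
        unfolding exp_add exp_of_nat2_mult exp_minus by (simp add: divide_inverse)
      finally have e2: "exp (- (2 * u J)\<^sup>2 / 2) \<le> exp (- 4 * z) * (1 / 2 ^ J) ^ 4" .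
      have "2 ^ (J + 1) * real (b J + 1) * (exp (- (u J - 1 / u J)\<^sup>2 / 2) / (u J - 1 / u J))
        \<le> 2 ^ (J + 1) * (real J powr (1 / 4) + 1) * (exp (1 - z) * (1 / 2 ^ J) / (u J - 1 / u J))"
        using du b1[of J] e1 by (intro mult_mono divide_right_mono) auto
      moreover have "exp (- (2 * u J)\<^sup>2 / 2) / (2 * u J) \<le> exp (- (2 * u J)\<^sup>2 / 2) / 1"
        using J(2) by (intro divide_left_mono) auto
      then have "real J * 2 ^ (J + 1) * (exp (- (2 * u J)\<^sup>2 / 2) / (2 * u J))
        \<le> real J * 2 ^ (J + 1) * (exp (- 4 * z) * (1 / 2 ^ J) ^ 4)"
        using e2 by (intro mult_left_mono) auto
      moreover have "real J * 2 ^ (J + 1) * (exp (- 4 * z) * (1 / 2 ^ J) ^ 4)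
        = real J * 2 * exp (- 4 * z) * (1 / 2 ^ J) ^ 3"
        by (simp add: field_simps eval_nat_numeral)
      moreover have "2 ^ (J + 1) * (real J powr (1 / 4) + 1) * (exp (1 - z) * (1 / 2 ^ J) / (u J - 1 / u J))
        = 2 * (real J powr (1 / 4) + 1) * exp (1 - z) / (u J - 1 / u J)"
        by simp
      moreover have "0 \<le> 2 ^ (J + 1) * real (b J + 1) * (exp (- (u J - 1 / u J)\<^sup>2 / 2) / (u J - 1 / u J))
        + real J * 2 ^ (J + 1) * (exp (- (2 * u J)\<^sup>2 / 2) / (2 * u J))"
        using du J by (intro add_nonneg_nonneg mult_nonneg_nonneg divide_nonneg_nonneg) auto
      ultimately show ?thesis by linarith
    qed
    show "eventually (\<lambda>J. 0 \<le> 2 ^ (J + 1) * real (b J + 1) * (exp (- (u J - 1 / u J)\<^sup>2 / 2) / (u J - 1 / u J))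
        + real J * 2 ^ (J + 1) * (exp (- (2 * u J)\<^sup>2 / 2) / (2 * u J))) sequentially"
      using u1 eventually_gt_at_top[of 0] by eventually_elim (use * in blast)
    show "eventually (\<lambda>J. 2 ^ (J + 1) * real (b J + 1) * (exp (- (u J - 1 / u J)\<^sup>2 / 2) / (u J - 1 / u J))
        + real J * 2 ^ (J + 1) * (exp (- (2 * u J)\<^sup>2 / 2) / (2 * u J))
      \<le> 2 * (real J powr (1 / 4) + 1) * exp (1 - z) / (u J - 1 / u J)
        + real J * 2 * exp (- 4 * z) * (1 / 2 ^ J) ^ 3) sequentially"
      using u1 eventually_gt_at_top[of 0] by eventually_elim (use * in blast)
  qed
qed

section \<open>From the wavelet hypotheses to the limit\<close>

lemma father_mother_wavelets_orthonormal:
  assumes "father_mother_wavelets \<phi> \<psi>"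
  shows "\<phi> \<in> L2_space" "\<psi> \<in> L2_space"
    and "L2_inner (int_translates \<phi> k) (int_translates \<phi> l) = (if k = l then 1 else 0)"
    and "L2_inner (int_translates \<psi> k) (int_translates \<psi> l) = (if k = l then 1 else 0)"
proof -
  obtain V where V: "multiresolution_analysis V \<phi>"
      "L2_orthonormal_basis (int_translates \<psi>) (detail_space V 0)"
    using assms by (auto simp: father_mother_wavelets_def)
  have sub: "V j \<subseteq> L2_space" for j
    using V(1) by (auto simp: multiresolution_analysis_def L2_closed_subspace_def)
  have 0: "int_translates f 0 = f" for f by (simp add: int_translates_def fun_eq_iff)
  have "int_translates \<phi> 0 \<in> V 0"
    using V(1) by (auto simp: multiresolution_analysis_def L2_orthonormal_basis_def)
  then show "\<phi> \<in> L2_space" using sub by (auto simp: 0)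
  have "int_translates \<psi> 0 \<in> V (0 + 1)"
    using V(2) by (auto simp: detail_space_def L2_orthonormal_basis_def)
  then show "\<psi> \<in> L2_space" using sub by (auto simp: 0)
  show "L2_inner (int_translates \<phi> k) (int_translates \<phi> l) = (if k = l then 1 else 0)"
    using V(1) by (simp add: multiresolution_analysis_def L2_orthonormal_basis_def)
  show "L2_inner (int_translates \<psi> k) (int_translates \<psi> l) = (if k = l then 1 else 0)"
    using V(2) by (simp add: L2_orthonormal_basis_def)
qed

lemma compactly_supported_L2_compact:
  assumes "compactly_supported f" "f \<in> L2_space"
  shows "f \<in> L2_compact"
proof -
  have "bounded {x. f x \<noteq> 0}"
    using assms(1) unfolding compactly_supported_def
    by (meson bounded_subset closure_subset compact_imp_bounded)
  then obtain R where "\<And>x. f x \<noteq> 0 \<Longrightarrow> \<bar>x\<bar> \<le> R" by (auto simp: bounded_iff)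
  then show ?thesis by (rule L2_compactI[OF assms(2)])
qed

theorem theorem1p5:
  fixes \<phi> \<psi> :: "real \<Rightarrow> real"
    and \<sigma> :: real
    and M :: "'a measure"
    and \<epsilon> :: "nat \<Rightarrow> nat \<Rightarrow> 'a \<Rightarrow> real"
  assumes "father_mother_wavelets \<phi> \<psi>"
    and "compactly_supported \<phi>" and "compactly_supported \<psi>"
    and "\<psi> C1_differentiable_on UNIV"
    and "\<sigma> > 0"
    and "prob_space M"
    and "\<And>J. prob_space.indep_vars M (\<lambda>_. borel) (\<epsilon> (2 ^ J)) {..<2 ^ J}"
    and "\<And>J l. l < 2 ^ J \<Longrightarrow> distributed M lborel (\<epsilon> (2 ^ J) l) (normal_density 0 \<sigma>)"
  shows "\<exists>c>0. \<forall>z::real.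
    liminf (\<lambda>J. let n = 2 ^ J :: nat in
      ereal (\<P>(x in M.
        (MAX \<omega>\<in>ti_index J. \<bar>vec_inner n (ti_wavelet \<phi> \<psi> J \<omega>) (\<lambda>l. \<epsilon> n l x)\<bar>)
          \<le> \<sigma> * sqrt (2 * ln (real n)) + \<sigma> * ((z + ln (c / pi)) / sqrt (2 * ln (real n))))))
    \<ge> ereal (exp (- exp (- z)))"
\<comment> \<open>With \<open>c = pi\<close> the term \<open>ln (c / pi)\<close> vanishes and the
  threshold is \<open>\<sigma> * u J\<close>.\<close>
proof (intro exI[of _ pi] conjI allI)
  fix z :: real
  interpret prob_space M by fact
  note on = father_mother_wavelets_orthonormal[OF assms(1)]
  have \<phi>: "\<phi> \<in> L2_compact" and \<psi>: "\<psi> \<in> L2_compact"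
    using assms(2,3) on by (auto intro: compactly_supported_L2_compact)
  obtain C where C: "C > 0" "\<And>a b j. \<bar>a - b\<bar> \<le> 1 \<Longrightarrow>
    periodic_inner (\<lambda>x. dilate \<psi> j a x - dilate \<psi> j b x) (\<lambda>x. dilate \<psi> j a x - dilate \<psi> j b x)
      \<le> C * (a - b)\<^sup>2"
    using L2_increment_bound[OF assms(4) \<psi>] by blast
  define u where "u = (\<lambda>J. sqrt (2 * ln (2 ^ J)) + z / sqrt (2 * ln (2 ^ J)))"
  define b where "b = (\<lambda>J. nat \<lfloor>real J powr (1 / 4)\<rfloor>)"
  define err where "err J = 2 ^ (J + 1) * real (b J + 1) * (exp (- (u J - 1 / u J)\<^sup>2 / 2) / (u J - 1 / u J))
      + real J * 2 ^ (J + 1) * (exp (- (2 * u J)\<^sup>2 / 2) / (2 * u J))" for J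
  define Q where "Q J = {x \<in> space M. (MAX \<omega>\<in>ti_index J.
      \<bar>vec_inner (2 ^ J) (ti_wavelet \<phi> \<psi> J \<omega>) (\<lambda>l. \<epsilon> (2 ^ J) l x)\<bar>) \<le> \<sigma> * u J}" for J
  have Q: "1 - err J \<le> prob (Q J)"
    if J: "J > 0" "u J > 1" and bJ: "C * (1 / 2 ^ b J)\<^sup>2 \<le> (1 / (2 * (u J)\<^sup>2))\<^sup>2" for J
  proof -
    \<comment> \<open>The pair \<open>(k, m)\<close> enters only through
      \<open>s = k * 2 ^ (J - j) + m\<close>, so one parameter per scale describes all its
      vectors.\<close>
    define v where "v j s l = periodic_inner (dilate \<psi> j (2 ^ j / 2 ^ J * real s)) (dilate \<phi> J (real l))"
      for j s l
    have [measurable]: "(\<lambda>x. vec_inner (2 ^ J) w (\<lambda>l. \<epsilon> (2 ^ J) l x)) \<in> borel_measurable M" for w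
      using distributed_measurable[OF assms(8)] by (intro vec_inner_measurable) simp
    define E where "E = {x\<in>space M. \<exists>j<J. \<exists>s<2 ^ (J + 1). \<sigma> * u J < \<bar>vec_inner (2 ^ J) (v j s) (\<lambda>l. \<epsilon> (2 ^ J) l x)\<bar>}"
    have E: "E \<in> events" unfolding E_def by measurable
    have "prob E \<le> err J"
      unfolding E_def err_def
    proof (rule multiscale_union_bound[OF assms(7,8,5) J(2)])
      fix j s :: nat
      show "(\<Sum>l<2 ^ J. (v j s l)\<^sup>2) \<le> 1"
        unfolding v_def
        using periodic_inner_bessel[OF \<phi> dilate_L2_compact[OF \<psi>, of j "2 ^ j / 2 ^ J * real s"] on(3), of J]
          periodic_inner_dilate_orthonormal[OF on(4), of 0 j "2 ^ j / 2 ^ J * real s"]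
        by simp
    next
      fix j s s' :: nat assume j: "j < J" and s: "s' \<le> s" "s - s' < 2 ^ (J - j - b J)"
      define a where "a s = (2::real) ^ j / 2 ^ J * real s" for s
      have a: "\<bar>a s - a s'\<bar> \<le> 1 / 2 ^ b J"
      \<comment> \<open>If \<open>j + b J \<ge> J\<close> the truncated exponent is 0 and forces
        \<open>s = s'\<close>. Otherwise the powers of two combine to
        \<open>1 / 2 ^ b J\<close>.\<close>
      proof (cases "s = s'")
        case False
        then have "0 < J - j - b J" using s by (cases "J - j - b J") auto
        then have "J = j + b J + (J - j - b J)" by simp
        then have pw: "(2::real) ^ J = 2 ^ j * 2 ^ b J * 2 ^ (J - j - b J)" by (metis power_add)
        have "real (s - s') \<le> 2 ^ (J - j - b J)" using s(2) by (simp add: less_imp_le flip: of_nat_le_iff)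
        then have "2 ^ j / 2 ^ J * real (s - s') \<le> 2 ^ j / 2 ^ J * 2 ^ (J - j - b J)"
          by (intro mult_left_mono) auto
        also have "\<dots> = 1 / 2 ^ b J" unfolding pw by simp
        finally have "2 ^ j / 2 ^ J * real (s - s') \<le> 1 / 2 ^ b J" .
        moreover have "a s - a s' = 2 ^ j / 2 ^ J * real (s - s')"
          using s(1) by (simp add: a_def of_nat_diff right_diff_distrib diff_divide_distrib)
        moreover have "0 \<le> 2 ^ j / (2::real) ^ J * real (s - s')" by simp
        ultimately show ?thesis by linarith
      qed simp
      also have "\<dots> \<le> 1" by simp
      finally have a1: "\<bar>a s - a s'\<bar> \<le> 1" .
      let ?D = "\<lambda>x. dilate \<psi> j (a s) x - dilate \<psi> j (a s') x"
      have D: "?D \<in> L2_compact" by (intro L2_compact_diff dilate_L2_compact \<psi>)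
      have "periodic_inner ?D (dilate \<phi> J (real l)) = v j s l - v j s' l" for l
        unfolding v_def a_def[symmetric]
        by (simp add: L2_inner_periodic_part[symmetric] D dilate_L2_compact \<phi> \<psi> periodic_part_diff
            L2_inner_diff_left periodic_part_L2_space)
      then have "(\<Sum>l<2 ^ J. (v j s l - v j s' l)\<^sup>2) \<le> periodic_inner ?D ?D"
        using periodic_inner_bessel[OF \<phi> D on(3), of J] by simp
      also have "\<dots> \<le> C * (a s - a s')\<^sup>2" by (rule C(2)[OF a1])
      also have "\<dots> \<le> C * (1 / 2 ^ b J)\<^sup>2"
        using C(1) a by (intro mult_left_mono) (auto simp: abs_le_square_iff[symmetric])
      finally show "(\<Sum>l<2 ^ J. (v j s l - v j s' l)\<^sup>2) \<le> (1 / (2 * (u J)\<^sup>2))\<^sup>2" using bJ by linarith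
    qed auto
    then have "1 - err J \<le> prob (space M - E)" using E by (simp add: prob_compl)
    also have "\<dots> \<le> prob (Q J)"
    proof (rule finite_measure_mono)
      have "ti_index J \<subseteq> {..<J} \<times> {..<2 ^ J} \<times> {..<2 ^ J}"
        by (auto simp: ti_index_def) (meson less_imp_le one_le_numeral order_less_le_trans power_increasing)
      then have fin: "finite (ti_index J)" by (rule finite_subset) auto
      \<comment> \<open>\<open>Max\<close> is meaningful only on a nonempty set, hence the
        restriction to \<open>J > 0\<close>.\<close>
      have ne: "ti_index J \<noteq> {}" using J(1) by (auto simp: ti_index_def intro!: exI[of _ 0])
      have Q_eq: "Q J = {x \<in> space M. \<forall>\<omega>\<in>ti_index J.
          \<bar>vec_inner (2 ^ J) (ti_wavelet \<phi> \<psi> J \<omega>) (\<lambda>l. \<epsilon> (2 ^ J) l x)\<bar> \<le> \<sigma> * u J}"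
        unfolding Q_def using fin ne by (subst Max_le_iff) auto
      show "Q J \<in> events" unfolding Q_eq using fin by (intro sets.sets_Collect_finite_All) measurable
      show "space M - E \<subseteq> Q J"
      proof
        fix x assume x: "x \<in> space M - E"
        have "\<bar>vec_inner (2 ^ J) (ti_wavelet \<phi> \<psi> J \<omega>) (\<lambda>l. \<epsilon> (2 ^ J) l x)\<bar> \<le> \<sigma> * u J"
          if \<omega>: "\<omega> \<in> ti_index J" for \<omega>
        proof -
          obtain j k m where w: "\<omega> = (j, k, m)" "j < J" "k < 2 ^ j" "m < 2 ^ J"
            using \<omega> by (auto simp: ti_index_def)
          define s where "s = k * 2 ^ (J - j) + m"
          \<comment> \<open>Both summands of \<open>s\<close> are at most \<open>2 ^ J\<close>, the
            second strictly less; this is the origin of the range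
            \<open>2 ^ (J + 1)\<close>.\<close>
          have "k * 2 ^ (J - j) \<le> 2 ^ j * 2 ^ (J - j)" using w(3) by simp
          then have s: "s < 2 ^ (J + 1)" using w(2,4) by (simp add: s_def power_add[symmetric])
          have "vec_inner (2 ^ J) (ti_wavelet \<phi> \<psi> J \<omega>) (\<lambda>l. \<epsilon> (2 ^ J) l x)
            = vec_inner (2 ^ J) (v j s) (\<lambda>l. \<epsilon> (2 ^ J) l x)"
            unfolding vec_inner_def w(1) v_def s_def
            by (intro sum.cong refl) (simp add: ti_wavelet_eq[OF \<phi> \<psi> w(2)])
          then show ?thesis using x w(2) s unfolding E_def by (metis (mono_tags, lifting) DiffE mem_Collect_eq not_less)
        qed
        then show "x \<in> Q J" using x by (simp add: Q_eq)
      qed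
    qed
    finally show ?thesis .
  qed
  have "eventually (\<lambda>J. u J > 1) sequentially"
      "eventually (\<lambda>J. C * (1 / 2 ^ b J)\<^sup>2 \<le> (1 / (2 * (u J)\<^sup>2))\<^sup>2) sequentially"
    unfolding u_def b_def by (rule gumbel_level_limits(1), rule gumbel_level_limits(2)[OF C(1)])
  then have ev: "eventually (\<lambda>J. ereal (1 - err J) \<le> ereal (prob (Q J))) sequentially"
    using eventually_gt_at_top[of 0] by eventually_elim (simp add: Q)
  have "err \<longlonglongrightarrow> 0"
    unfolding err_def[abs_def] u_def b_def by (rule gumbel_level_limits(3))
  then have "(\<lambda>J. 1 - err J) \<longlonglongrightarrow> 1 - 0"
    by (intro tendsto_diff tendsto_const)
  then have "liminf (\<lambda>J. ereal (1 - err J)) = ereal 1"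
    by (intro lim_imp_Liminf) auto
  then have "ereal 1 \<le> liminf (\<lambda>J. ereal (prob (Q J)))"
    using Liminf_mono[OF ev] by simp
  moreover have "exp (- exp (- z)) \<le> 1" by simp
  ultimately have "ereal (exp (- exp (- z))) \<le> liminf (\<lambda>J. ereal (prob (Q J)))"
    by (meson ereal_less_eq(3) order_trans)
  then show "ereal (exp (- exp (- z))) \<le> liminf (\<lambda>J. let n = 2 ^ J :: nat in
      ereal (\<P>(x in M.
        (MAX \<omega>\<in>ti_index J. \<bar>vec_inner n (ti_wavelet \<phi> \<psi> J \<omega>) (\<lambda>l. \<epsilon> n l x)\<bar>)
          \<le> \<sigma> * sqrt (2 * ln (real n)) + \<sigma> * ((z + ln (pi / pi)) / sqrt (2 * ln (real n))))))"
    by (simp add: Q_def u_def Let_def distrib_left)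
qed simp

end
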